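(* Let $\phi=\forall x\forall y:\psi(x,y)\wedge Linear(\leq)$, where $\forall x\forall y:\psi(x,y)$ is a universally quantified $\mathbf{FO}^2$ sentence in prenex normal form ($\psi$ quantifier-free) and the binary predicate $\leq$ is one of its predicates, and let $(w,\overline{w})$ be weightings with $w(\leq)=\overline{w}(\leq)=1$. The algorithm IncrementalWFOMC (given in the context) run with the values $$r_{ij}=\mathsf{WMC}\big(\psi_{ij}(A,B)\wedge(B\leq A)\wedge\neg(A\leq B),\,w',\overline{w}'\big)$$ computes the weighted first-order model count of $\phi$ on the ordered domain $\Delta=\{1\leq 2\leq\dots\leq n\}$, that is, its output equals $$\sum_{\omega}\ \prod_{l\in\omega}w(\mathsf{pred}(l))\prod_{l\in\mathsf{HB}\setminus\omega}\overline{w}(\mathsf{pred}(l)),$$ where the sum is over all possible worlds $\omega\subseteq\mathsf{HB}$ over $\Delta=\{1,\dots,n\}$ with $\omega\models\forall x\forall y:\psi(x,y)$ and with $\omega[\leq]$ equal to the order $1\leq 2\leq\dots\leq n$. Moreover, it does so in time polynomial in the domain size $n$.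
   Context: Logic. Function-free first-order logic over a finite set $\mathcal{P}$ of predicates, with Herbrand semantics over the finite domain $\Delta=\{1,\dots,n\}$; $\mathbf{FO}^2$ sentences contain at most two logical variables and are assumed to be constant-free. $\mathsf{HB}$ is the set of all ground atoms, a possible world is a subset $\omega\subseteq\mathsf{HB}$ (the true atoms), $\omega[P]$ is the set of atoms of $\omega$ with predicate $P$, and $\mathsf{pred}(l)$ is the predicate of the atom $l$. Weightings are functions $w,\overline{w}:\mathcal{P}\to\mathbb{R}$; they induce weights on ground atoms via $\mathsf{pred}$. For a propositional formula $\alpha$ over a finite set $V$ of propositional variables with weights $w,\overline w:V\to\mathbb{R}$, $\mathsf{WMC}(\alpha,w,\overline w)=\sum_{\omega\subseteq V,\ \omega\models\alpha}\prod_{l\in\omega}w(l)\prod_{l\in V\setminus\omega}\overline w(l)$. $Linear(\leq)$ holds in $\omega$ iff $\omega[\leq]$ is a linear (total, reflexive, antisymmetric, transitive) order on $\Delta$. Cells. A cell of a formula is a maximally consistent set (conjunction) of literals formed from atoms in the formula using only a single variable. A cell of $\psi(x,y)$ is valid if it is a model of $\psi(x,x)$ and (because of the linear order axiom) contains the literal $x\leq x$. Let $C_1,\dots,C_p$ be the valid cells. For two distinct constants $A,B$ put $\psi_{ij}(A,B)=\psi(A,B)\wedge\psi(B,A)\wedge C_i(A)\wedge C_j(B)$ and $\psi_k(A)=\psi(A,A)\wedge C_k(A)$; these are regarded as propositional formulas over the ground atoms over $\{A,B\}$, resp. $\{A\}$. Set $w_k=\mathsf{WMC}(\psi_k(A),w,\overline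 w)$. The weights $w',\overline w'$ agree with $w,\overline w$ except that the atoms appearing in the cells conditioned on (the atoms of $C_i(A)$ and $C_j(B)$) get both weights equal to $1$. Algorithm IncrementalWFOMC. Vectors $\mathbf{k}\in\mathbb{N}^p$ ($0\in\mathbb{N}$), $|\mathbf{k}|=\sum_l(\mathbf{k})_l$, $\boldsymbol\delta_j$ the $j$-th unit vector, $0^0=1$. Tables $T_i$ ($1\le i\le n$) indexed by $\mathbf{k}\in\mathbb{N}^p$ with $|\mathbf{k}|=i$ are initialised to $0$; set $T_1[\boldsymbol\delta_j]=w_j$ for each $j\in\{1,\dots,p\}$. For $i=2,\dots,n$, for each $j\in\{1,\dots,p\}$ and each $\mathbf{k}_{old}$ with $|\mathbf{k}_{old}|=i-1$, add $T_{i-1}[\mathbf{k}_{old}]\cdot w_j\cdot\prod_{l=1}^p r_{jl}^{(\mathbf{k}_{old})_l}$ to $T_i[\mathbf{k}_{old}+\boldsymbol\delta_j]$. Output $\sum_{|\mathbf{k}|=n}T_n[\mathbf{k}]$.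
   Formalization: All predicates are taken to be unary or binary, and cells are formed from all predicates of the vocabulary, since the claimed equality fails for nullary or ternary predicates and for cells that omit a predicate not occurring in the formula. *)

theory Defs
  imports Complex_Main
    "HOL-Computational_Algebra.Polynomial"
    "HOL-Library.Monad_Syntax"
begin

section \<open>Propositional formulas and weighted model counting\<close>

datatype 'a fm =
    Bot
  | Atm 'a
  | Neg "'a fm"
  | And "'a fm" "'a fm"
  | Or "'a fm" "'a fm"
  | Imp "'a fm" "'a fm"

text \<open>An interpretation is the set of its true atoms.\<close>

primrec sat :: "'a set \<Rightarrow> 'a fm \<Rightarrow> bool" where
  "sat \<omega> Bot \<longleftrightarrow> False"
| "sat \<omega> (Atm a) \<longleftrightarrow> a \<in> \<omega>"
| "sat \<omega> (Neg F) \<longleftrightarrow> \<not> sat \<omega> F"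
| "sat \<omega> (And F G) \<longleftrightarrow> sat \<omega> F \<and> sat \<omega> G"
| "sat \<omega> (Or F G) \<longleftrightarrow> sat \<omega> F \<or> sat \<omega> G"
| "sat \<omega> (Imp F G) \<longleftrightarrow> (sat \<omega> F \<longrightarrow> sat \<omega> G)"

text \<open>The second argument is a set of formulas, read as their conjunction. In this way a cell,
  which is a set of literals, needs no arbitrary choice of an order for its conjuncts.\<close>

definition wmc ::
  "'a set \<Rightarrow> 'a fm set \<Rightarrow> ('a \<Rightarrow> real) \<Rightarrow> ('a \<Rightarrow> real) \<Rightarrow> real" where
  "wmc V \<Gamma> w wb =
     (\<Sum>\<omega> | \<omega> \<subseteq> V \<and> (\<forall>F\<in>\<Gamma>. sat \<omega> F). (\<Prod>l\<in>\<omega>. w l) * (\<Prod>l\<in>V - \<omega>. wb l))"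

section \<open>Function-free first-order atoms and the weighted first-order model count\<close>

datatype ('p, 't) atom = Atom (pred: 'p) (args: "'t list")

datatype var = Vx | Vy

definition atoms_over :: "'p set \<Rightarrow> ('p \<Rightarrow> nat) \<Rightarrow> 't set \<Rightarrow> ('p, 't) atom set" where
  "atoms_over Ps ar D = {Atom P ts | P ts. P \<in> Ps \<and> length ts = ar P \<and> set ts \<subseteq> D}"

text \<open>A quantifier-free constant-free formula \<open>\<psi>(x,y)\<close> of the two-variable fragment has type
  \<open>('p, var) atom fm\<close>; \<open>inst2 \<psi> a b\<close> is \<open>\<psi>(a,b)\<close>, a propositional formula over ground atoms.\<close>

definition inst :: "('t \<Rightarrow> 'c) \<Rightarrow> ('p, 't) atom fm \<Rightarrow> ('p, 'c) atom fm" where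
  "inst \<sigma> = map_fm (map_atom id \<sigma>)"

definition inst2 :: "('p, var) atom fm \<Rightarrow> 'c \<Rightarrow> 'c \<Rightarrow> ('p, 'c) atom fm" where
  "inst2 \<psi> a b = inst (case_var a b) \<psi>"

definition models_forall2 :: "'c set \<Rightarrow> ('p, 'c) atom set \<Rightarrow> ('p, var) atom fm \<Rightarrow> bool" where
  "models_forall2 D \<omega> \<psi> \<longleftrightarrow> (\<forall>a\<in>D. \<forall>b\<in>D. sat \<omega> (inst2 \<psi> a b))"

definition proj :: "('p, 'c) atom set \<Rightarrow> 'p \<Rightarrow> ('p, 'c) atom set" where
  "proj \<omega> P = {l \<in> \<omega>. pred l = P}"

definition wfomc_ordered ::
  "'p set \<Rightarrow> ('p \<Rightarrow> nat) \<Rightarrow> 'p \<Rightarrow> ('p, var) atom fm \<Rightarrow> ('p \<Rightarrow> real) \<Rightarrow> ('p \<Rightarrow> real) \<Rightarrow> nat \<Rightarrow> real"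
where
  "wfomc_ordered Ps ar le \<psi> w wb n =
     (let HB = atoms_over Ps ar {1..n} in
      \<Sum>\<omega> | \<omega> \<subseteq> HB \<and> models_forall2 {1..n} \<omega> \<psi> \<and>
            proj \<omega> le = {Atom le [a, b] | a b. 1 \<le> a \<and> a \<le> b \<and> b \<le> n}.
        (\<Prod>l\<in>\<omega>. w (pred l)) * (\<Prod>l\<in>HB - \<omega>. wb (pred l)))"

section \<open>Cells\<close>

text \<open>The atoms using only the variable \<open>x\<close> are \<open>P(x)\<close> and \<open>R(x,x)\<close> for all unary \<open>P\<close> and binary
  \<open>R\<close> of the vocabulary, whether or not, say, \<open>R(x,x)\<close> itself is a subformula of \<open>\<psi>\<close>.\<close>

definition cell_literals :: "'p set \<Rightarrow> ('p \<Rightarrow> nat) \<Rightarrow> ('p, var) atom fm set" where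
  "cell_literals Ps ar = Atm ` atoms_over Ps ar {Vx} \<union> (Neg \<circ> Atm) ` atoms_over Ps ar {Vx}"

definition consistent :: "'a fm set \<Rightarrow> bool" where
  "consistent L \<longleftrightarrow> (\<nexists>a. Atm a \<in> L \<and> Neg (Atm a) \<in> L)"

definition is_cell :: "'p set \<Rightarrow> ('p \<Rightarrow> nat) \<Rightarrow> ('p, var) atom fm set \<Rightarrow> bool" where
  "is_cell Ps ar c \<longleftrightarrow> c \<subseteq> cell_literals Ps ar \<and> consistent c \<and>
     (\<forall>c'. c \<subset> c' \<and> c' \<subseteq> cell_literals Ps ar \<longrightarrow> \<not> consistent c')"

definition valid_cell ::
  "'p set \<Rightarrow> ('p \<Rightarrow> nat) \<Rightarrow> 'p \<Rightarrow> ('p, var) atom fm \<Rightarrow> ('p, var) atom fm set \<Rightarrow> bool" where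
  "valid_cell Ps ar le \<psi> c \<longleftrightarrow> is_cell Ps ar c \<and>
     sat {a. Atm a \<in> c} (inst2 \<psi> Vx Vx) \<and> Atm (Atom le [Vx, Vx]) \<in> c"

definition cell_at :: "('p, var) atom fm set \<Rightarrow> 'c \<Rightarrow> ('p, 'c) atom fm set" where
  "cell_at c a = inst (\<lambda>_. a) ` c"

section \<open>The values used by the algorithm\<close>

definition psi1 :: "('p, var) atom fm \<Rightarrow> ('p, var) atom fm set \<Rightarrow> 'c \<Rightarrow> ('p, 'c) atom fm set" where
  "psi1 \<psi> c A = {inst2 \<psi> A A} \<union> cell_at c A"

definition psi2 ::
  "('p, var) atom fm \<Rightarrow> ('p, var) atom fm set \<Rightarrow> ('p, var) atom fm set \<Rightarrow> 'c \<Rightarrow> 'c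
    \<Rightarrow> ('p, 'c) atom fm set" where
  "psi2 \<psi> c d A B = {inst2 \<psi> A B, inst2 \<psi> B A} \<union> cell_at c A \<union> cell_at d B"

definition cell_weight ::
  "'p set \<Rightarrow> ('p \<Rightarrow> nat) \<Rightarrow> ('p, var) atom fm \<Rightarrow> ('p \<Rightarrow> real) \<Rightarrow> ('p \<Rightarrow> real) \<Rightarrow> 'c
    \<Rightarrow> ('p, var) atom fm set \<Rightarrow> real" where
  "cell_weight Ps ar \<psi> w wb A c =
     wmc (atoms_over Ps ar {A}) (psi1 \<psi> c A) (w \<circ> pred) (wb \<circ> pred)"

definition unweight :: "'a set \<Rightarrow> ('a \<Rightarrow> real) \<Rightarrow> 'a \<Rightarrow> real" where
  "unweight S v = (\<lambda>l. if l \<in> S then 1 else v l)"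

definition pair_weight ::
  "'p set \<Rightarrow> ('p \<Rightarrow> nat) \<Rightarrow> 'p \<Rightarrow> ('p, var) atom fm \<Rightarrow> ('p \<Rightarrow> real) \<Rightarrow> ('p \<Rightarrow> real) \<Rightarrow> 'c \<Rightarrow> 'c
    \<Rightarrow> ('p, var) atom fm set \<Rightarrow> ('p, var) atom fm set \<Rightarrow> real" where
  "pair_weight Ps ar le \<psi> w wb A B c d =
     (let S = \<Union> (set_fm ` (cell_at c A \<union> cell_at d B)) in
      wmc (atoms_over Ps ar {A, B})
        (psi2 \<psi> c d A B \<union> {Atm (Atom le [B, A]), Neg (Atm (Atom le [A, B]))})
        (unweight S (w \<circ> pred)) (unweight S (wb \<circ> pred)))"

section \<open>Computations with a step count\<close>

text \<open>A computation is a result together with the number of elementary steps spent on it.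
  The cost model is the unit-cost random access machine over the reals: an arithmetic operation
  on reals takes one step, and so does a loop iteration, which covers the arithmetic on loop
  counters and the access to the input values for the current counters.  Operations on lists
  are charged by their length.\<close>

datatype 'a tm = TM (result: 'a) (steps: nat)

definition bind_tm :: "'a tm \<Rightarrow> ('a \<Rightarrow> 'b tm) \<Rightarrow> 'b tm" where
  "bind_tm m f = (let m' = f (result m) in TM (result m') (steps m + steps m'))"

adhoc_overloading Monad_Syntax.bind \<rightleftharpoons> bind_tm

definition return :: "'a \<Rightarrow> 'a tm" where
  "return x = TM x 0"

definition charge :: "nat \<Rightarrow> unit tm" where
  "charge t = TM () t"

primrec for_each :: "'a list \<Rightarrow> ('a \<Rightarrow> 's \<Rightarrow> 's tm) \<Rightarrow> 's \<Rightarrow> 's tm" where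
  "for_each [] f s = return s"
| "for_each (x # xs) f s = do { charge 1; s' \<leftarrow> f x s; for_each xs f s' }"

definition add_tm :: "real \<Rightarrow> real \<Rightarrow> real tm" where
  "add_tm x y = do { charge 1; return (x + y) }"

definition mult_tm :: "real \<Rightarrow> real \<Rightarrow> real tm" where
  "mult_tm x y = do { charge 1; return (x * y) }"

primrec power_tm :: "real \<Rightarrow> nat \<Rightarrow> real tm" where
  "power_tm x 0 = do { charge 1; return 1 }"
| "power_tm x (Suc m) = do { y \<leftarrow> power_tm x m; mult_tm x y }"

section \<open>The algorithm IncrementalWFOMC\<close>

text \<open>Vectors in \<open>\<nat>\<^sup>p\<close> are lists of length \<open>p\<close>, so coordinates and cells are numbered from \<open>0\<close>.
  Entries, unit vectors and sums with unit vectors take time linear in \<open>p\<close>.\<close>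

definition entry_tm :: "nat list \<Rightarrow> nat \<Rightarrow> nat tm" where
  "entry_tm k l = do { charge (Suc l); return (k ! l) }"

definition add_unit_tm :: "nat list \<Rightarrow> nat \<Rightarrow> nat list tm" where
  "add_unit_tm k j = do { charge (Suc (length k)); return (k[j := k ! j + 1]) }"

definition unit_tm :: "nat \<Rightarrow> nat \<Rightarrow> nat list tm" where
  "unit_tm p j = do { charge (Suc p); return ((replicate p 0)[j := 1]) }"

text \<open>All vectors \<open>k \<in> \<nat>\<^sup>p\<close> with \<open>|k| = m\<close>, each listed once.\<close>

primrec vectors_tm :: "nat \<Rightarrow> nat \<Rightarrow> nat list list tm" where
  "vectors_tm 0 = (\<lambda>m. do { charge 1; return (if m = 0 then [[]] else []) })"
| "vectors_tm (Suc p) = (\<lambda>m.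
     for_each [0..<Suc m]
       (\<lambda>a acc. do {
          vs \<leftarrow> vectors_tm p (m - a);
          charge (length vs);
          return (map ((#) a) vs @ acc) })
       [])"

text \<open>A table is a \<open>p\<close>-dimensional array; access takes time linear in the length of the index.
  Entries that were never written have no content.\<close>

type_synonym table = "nat list \<rightharpoonup> real"

definition read_tm :: "table \<Rightarrow> nat list \<Rightarrow> real tm" where
  "read_tm T k = do { charge (Suc (length k)); return (the (T k)) }"

definition write_tm :: "table \<Rightarrow> nat list \<Rightarrow> real \<Rightarrow> table tm" where
  "write_tm T k v = do { charge (Suc (length k)); return (T(k \<mapsto> v)) }"

definition zero_table_tm :: "nat \<Rightarrow> nat \<Rightarrow> table tm" where
  "zero_table_tm p i = do {
     ks \<leftarrow> vectors_tm p i;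
     for_each ks (\<lambda>k T. write_tm T k 0) Map.empty }"

definition first_table_tm :: "nat \<Rightarrow> (nat \<Rightarrow> real) \<Rightarrow> table tm" where
  "first_table_tm p W = do {
     T \<leftarrow> zero_table_tm p 1;
     for_each [0..<p] (\<lambda>j T. do { d \<leftarrow> unit_tm p j; write_tm T d (W j) }) T }"

definition power_prod_tm :: "nat \<Rightarrow> (nat \<Rightarrow> nat \<Rightarrow> real) \<Rightarrow> nat \<Rightarrow> nat list \<Rightarrow> real tm" where
  "power_prod_tm p r j k =
     for_each [0..<p]
       (\<lambda>l acc. do { e \<leftarrow> entry_tm k l; x \<leftarrow> power_tm (r j l) e; mult_tm acc x }) 1"

definition next_table_tm ::
  "nat \<Rightarrow> (nat \<Rightarrow> real) \<Rightarrow> (nat \<Rightarrow> nat \<Rightarrow> real) \<Rightarrow> nat \<Rightarrow> table \<Rightarrow> table tm" where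
  "next_table_tm p W r i Told = do {
     Tnew \<leftarrow> zero_table_tm p i;
     for_each [0..<p]
       (\<lambda>j T. do {
          ks \<leftarrow> vectors_tm p (i - 1);
          for_each ks
            (\<lambda>kold T. do {
               t \<leftarrow> read_tm Told kold;
               tw \<leftarrow> mult_tm t (W j);
               q \<leftarrow> power_prod_tm p r j kold;
               x \<leftarrow> mult_tm tw q;
               knew \<leftarrow> add_unit_tm kold j;
               y \<leftarrow> read_tm T knew;
               z \<leftarrow> add_tm y x;
               write_tm T knew z })
            T })
       Tnew }"

definition incremental_wfomc ::
  "nat \<Rightarrow> (nat \<Rightarrow> real) \<Rightarrow> (nat \<Rightarrow> nat \<Rightarrow> real) \<Rightarrow> nat \<Rightarrow> real tm" where
  "incremental_wfomc p W r n = do {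
     T1 \<leftarrow> first_table_tm p W;
     T \<leftarrow> for_each [2..<Suc n] (\<lambda>i T. next_table_tm p W r i T) T1;
     ks \<leftarrow> vectors_tm p n;
     for_each ks (\<lambda>k s. do { t \<leftarrow> read_tm T k; add_tm s t }) 0 }"

end

theory Submission
  imports Defs "HOL-Library.FuncSet"
begin

text \<open>Every atom over \<open>{1..n}\<close> mentions either exactly one constant or exactly two, so the ground
  atoms split into disjoint blocks indexed by the constants and by the pairs \<open>a < b\<close>.  The atoms of the
  first kind determine the cell of each constant.  Once all cells are fixed, the constraints and the
  weights factor over the pairs, and because the order is the natural one, the factor of a pair
  \<open>a < b\<close> is \<open>r\<^sub>i\<^sub>j\<close> for the cell \<open>i\<close> of the later element \<open>b\<close> and the cell \<open>j\<close> of \<open>a\<close>.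
  Hence the model count is a sum over cell sequences of a weight that is computed by appending
  one element at a time.  The new factor depends on the earlier cells only through their multiplicities,
  so the algorithm may group the sequences by their cell counts.\<close>


section \<open>Result and cost of IncrementalWFOMC\<close>

text \<open>Without an order, pairs of elements could be counted by a closed multinomial formula,
  because exchanging two elements changes nothing. Here \<open>r i j\<close> and
  \<open>r j i\<close> differ in general: the first index belongs to the later element. Two cell
  sequences with the same counts may then have different weights, so the sum has to be built up
  element by element, and the invariant of the tables speaks about sums over sequences. Setting the
  weights of the conditioned atoms to 1 in \<open>pair_weight\<close> prevents multiple counting:
  the atoms of a single constant occur in the pair formula of every partner of that constant, but
  are to be paid for once, by \<open>cell_weight\<close>. The values given to the algorithm are
  computed at two arbitrary constants \<open>A\<close> and \<open>B\<close>, whose type need not be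
  \<open>nat\<close>, so weighted counts must be carried along renamings of constants. The time
  bound is polynomial because the number \<open>p\<close> of valid cells does not depend on
  \<open>n\<close>, and a table for \<open>i\<close> elements has at most \<open>(i + 1) ^ p\<close>
  entries.\<close>

lemma result_bind_tm [simp]: "result (bind_tm m f) = result (f (result m))"
  by (simp add: bind_tm_def Let_def)

lemma steps_bind_tm [simp]: "steps (bind_tm m f) = steps m + steps (f (result m))"
  by (simp add: bind_tm_def Let_def)

lemma return_simps [simp]: "result (return x) = x" "steps (return x) = 0"
  by (simp_all add: return_def)

lemma charge_simps [simp]: "result (charge t) = ()" "steps (charge t) = t"
  by (simp_all add: charge_def)

lemma result_for_each: "result (for_each xs f s) = fold (\<lambda>x s. result (f x s)) xs s"
  by (induction xs arbitrary: s) simp_all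

text \<open>The extra 1 in \<open>Suc c\<close> is the charge for the iteration itself. The bound on
  the body is required for every state, since the state changes along the loop.\<close>

lemma steps_for_each_le:
  assumes "\<And>x s. x \<in> set xs \<Longrightarrow> steps (f x s) \<le> c"
  shows "steps (for_each xs f s) \<le> length xs * Suc c"
  using assms
proof (induction xs arbitrary: s)
  case (Cons x xs)
  have "steps (f x s) \<le> c" "steps (for_each xs f (result (f x s))) \<le> length xs * Suc c"
    using Cons by simp_all
  then show ?case
    by simp
qed simp

lemma power_tm_simps [simp]: "result (power_tm x m) = x ^ m" "steps (power_tm x m) = Suc m"
  by (induction m) (simp_all add: mult_tm_def)

lemmas elementary_tm_defs =
  add_tm_def mult_tm_def entry_tm_def add_unit_tm_def unit_tm_def read_tm_def write_tm_def

section \<open>Enumeration of the index vectors\<close>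

lemma fold_append_map:
  "fold (\<lambda>a acc. f a @ acc) as acc = concat (map f (rev as)) @ acc"
  by (induction as arbitrary: acc) simp_all

lemma result_vectors_tm_Suc:
  "result (vectors_tm (Suc p) m)
     = concat (map (\<lambda>a. map ((#) a) (result (vectors_tm p (m - a)))) (rev [0..<Suc m]))"
  by (simp add: result_for_each fold_append_map del: upt_Suc)

lemma set_vectors_tm: "set (result (vectors_tm p m)) = {k. length k = p \<and> sum_list k = m}"
proof (induction p arbitrary: m)
  case (Suc p)
  have "set (result (vectors_tm (Suc p) m))
      = (\<Union>a\<in>{..m}. (#) a ` {k. length k = p \<and> sum_list k = m - a})"
    unfolding result_vectors_tm_Suc set_concat set_map set_rev set_upt image_image Suc.IH
    by (simp add: atLeast0LessThan lessThan_Suc_atMost)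
  also have "\<dots> = {k. length k = Suc p \<and> sum_list k = m}"
  proof (intro subset_antisym subsetI)
    fix k
    assume "k \<in> {k. length k = Suc p \<and> sum_list k = m}"
    then obtain a k' where "k = a # k'" "length k' = p" "a + sum_list k' = m"
      by (auto simp: length_Suc_conv)
    then show "k \<in> (\<Union>a\<in>{..m}. (#) a ` {k. length k = p \<and> sum_list k = m - a})"
      by (intro UN_I[of a] image_eqI[of _ _ k']) auto
  qed auto
  finally show ?case .
qed auto

lemma finite_vectors [simp]: "finite {k :: nat list. length k = p \<and> sum_list k = m}"
  using finite_set[of "result (vectors_tm p m)"] by (simp only: set_vectors_tm)

text \<open>Batches for different \<open>a\<close> cannot meet, because \<open>a\<close> is the
  first entry of all their vectors.\<close>

lemma distinct_vectors_tm: "distinct (result (vectors_tm p m))"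
proof (induction p arbitrary: m)
  case (Suc p)
  have "distinct (concat (map (\<lambda>a. map ((#) a) (result (vectors_tm p (m - a)))) as))"
    if "distinct as" for as
    using that by (induction as) (auto simp: distinct_map Suc.IH)
  from this[of "rev [0..<Suc m]"] show ?case
    unfolding result_vectors_tm_Suc by (simp only: distinct_rev distinct_upt)
qed simp

text \<open>A crude count is enough: each of the \<open>p\<close> entries lies between 0 and
  \<open>m\<close>. For fixed \<open>p\<close> this is polynomial in \<open>m\<close>, which is the
  source of the polynomial running time.\<close>

lemma length_vectors_tm_le: "length (result (vectors_tm p m)) \<le> Suc m ^ p"
proof (induction p arbitrary: m)
  case (Suc p)
  have "length (result (vectors_tm (Suc p) m))
          = (\<Sum>a\<leftarrow>rev [0..<Suc m]. length (result (vectors_tm p (m - a))))"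
    unfolding result_vectors_tm_Suc by (simp add: length_concat comp_def del: upt_Suc)
  also have "\<dots> \<le> (\<Sum>a\<leftarrow>rev [0..<Suc m]. Suc m ^ p)"
  proof (rule sum_list_mono)
    fix a
    have "length (result (vectors_tm p (m - a))) \<le> Suc (m - a) ^ p"
      by (rule Suc.IH)
    also have "\<dots> \<le> Suc m ^ p"
      by (rule power_mono) simp_all
    finally show "length (result (vectors_tm p (m - a))) \<le> Suc m ^ p" .
  qed
  finally show ?case
    by (simp add: sum_list_triv del: upt_Suc)
qed simp

text \<open>The factor grows by 2 per coordinate: 1 for copying the vectors of a batch, and 1 for
  the loop iterations, whose unit charge is absorbed by \<open>1 \<le> Suc m ^ p\<close>.\<close>

lemma steps_vectors_tm_le: "steps (vectors_tm p m) \<le> (2 * p + 1) * Suc m ^ p"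
proof (induction p arbitrary: m)
  case (Suc p)
  have *: "steps (vectors_tm p (m - a)) + length (result (vectors_tm p (m - a)))
      \<le> (2 * p + 2) * Suc m ^ p" for a
  proof -
    have "steps (vectors_tm p (m - a)) + length (result (vectors_tm p (m - a)))
        \<le> (2 * p + 1) * Suc (m - a) ^ p + Suc (m - a) ^ p"
      by (intro add_mono Suc.IH length_vectors_tm_le)
    also have "\<dots> = (2 * p + 2) * Suc (m - a) ^ p"
      by (simp add: algebra_simps)
    also have "\<dots> \<le> (2 * p + 2) * Suc m ^ p"
      by (intro mult_left_mono power_mono) simp_all
    finally show ?thesis .
  qed
  have "steps (vectors_tm (Suc p) m) \<le> length [0..<Suc m] * Suc ((2 * p + 2) * Suc m ^ p)"
    unfolding vectors_tm.simps
    by (rule steps_for_each_le) (use * in simp)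
  also have "\<dots> \<le> Suc m * ((2 * p + 3) * Suc m ^ p)"
  proof (rule mult_mono)
    have "1 \<le> Suc m ^ p"
      by simp
    then have "Suc ((2 * p + 2) * Suc m ^ p) \<le> (2 * p + 2) * Suc m ^ p + Suc m ^ p"
      by linarith
    also have "\<dots> = (2 * p + 3) * Suc m ^ p"
      by (simp add: distrib_right)
    finally show "Suc ((2 * p + 2) * Suc m ^ p) \<le> (2 * p + 3) * Suc m ^ p" .
  qed simp_all
  finally show ?case
    by (simp add: algebra_simps del: upt_Suc)
qed simp

lemma read_result_zero_table_tm:
  assumes "length k = p" "sum_list k = i"
  shows "the (result (zero_table_tm p i) k) = 0"
proof -
  \<comment> \<open>The initial table is generalised for the induction: at each moment the key is
    either still to be written or already holds 0.\<close>
  have "the (fold (\<lambda>k T. T(k \<mapsto> 0)) ks T k) = (0::real)"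
    if "k \<in> set ks \<or> T k = Some 0" for ks and T :: table
    using that by (induction ks arbitrary: T) auto
  then show ?thesis
    using assms by (simp add: zero_table_tm_def result_for_each elementary_tm_defs set_vectors_tm)
qed

section \<open>Tables as sums over cell sequences\<close>

definition cell_counts :: "nat \<Rightarrow> nat list \<Rightarrow> nat list" where
  "cell_counts p xs = map (count_list xs) [0..<p]"

definition cell_seqs :: "nat \<Rightarrow> nat \<Rightarrow> nat list set" where
  "cell_seqs p i = {xs. set xs \<subseteq> {..<p} \<and> length xs = i}"

text \<open>Cell sequences are listed newest element first.\<close>

primrec seq_weight :: "(nat \<Rightarrow> real) \<Rightarrow> (nat \<Rightarrow> nat \<Rightarrow> real) \<Rightarrow> nat list \<Rightarrow> real" where
  "seq_weight W r [] = 1"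
| "seq_weight W r (j # xs) = seq_weight W r xs * W j * (\<Prod>l\<leftarrow>xs. r j l)"

lemma finite_cell_seqs [simp]: "finite (cell_seqs p i)"
  unfolding cell_seqs_def by (rule finite_lists_length_eq) simp

lemma cell_seqs_Suc: "cell_seqs p (Suc i) = (\<lambda>(j, xs). j # xs) ` ({..<p} \<times> cell_seqs p i)"
  by (auto simp: cell_seqs_def length_Suc_conv image_iff)

lemma length_cell_counts [simp]: "length (cell_counts p xs) = p"
  by (simp add: cell_counts_def)

lemma sum_list_cell_counts:
  assumes "set xs \<subseteq> {..<p}"
  shows "sum_list (cell_counts p xs) = length xs"
proof -
  have "sum_list (cell_counts p xs) = (\<Sum>l<p. count_list xs l)"
    by (simp add: cell_counts_def interv_sum_list_conv_sum_set_nat atLeast0LessThan)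
  also have "\<dots> = (\<Sum>l\<in>set xs. count_list xs l)"
    by (rule sum.mono_neutral_right) (use assms in \<open>auto simp: count_list_0_iff\<close>)
  finally show ?thesis
    by (simp add: sum_count_set)
qed

text \<open>Appending an element of cell \<open>j\<close> moves the index exactly as the algorithm
  does when it passes from \<open>kold\<close> to \<open>knew\<close>.\<close>

lemma cell_counts_Cons:
  "j < p \<Longrightarrow> cell_counts p (j # xs) = (cell_counts p xs)[j := cell_counts p xs ! j + 1]"
  by (rule nth_equalityI) (auto simp: cell_counts_def nth_list_update)

lemma prod_list_eq_power_count:
  fixes g :: "nat \<Rightarrow> real"
  assumes "set xs \<subseteq> {..<p}"
  shows "(\<Prod>l\<leftarrow>xs. g l) = (\<Prod>l<p. g l ^ count_list xs l)"
  using assms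
proof (induction xs)
  case (Cons x xs)
  have "(\<Prod>l<p. g l ^ count_list (x # xs) l)
          = (\<Prod>l<p. (if l = x then g l else 1) * g l ^ count_list xs l)"
    by (rule prod.cong) auto
  also have "\<dots> = g x * (\<Prod>l<p. g l ^ count_list xs l)"
    using Cons.prems by (subst prod.distrib) (simp add: prod.delta')
  finally show ?case
    using Cons by simp
qed simp

lemma fold_mult_eq: "fold (\<lambda>l acc. acc * g l) ls (a::real) = a * (\<Prod>l\<leftarrow>ls. g l)"
  by (induction ls arbitrary: a) (simp_all add: algebra_simps)

lemma result_power_prod_tm:
  "result (power_prod_tm p r j k) = (\<Prod>l<p. r j l ^ (k ! l))"
proof -
  have "(\<Prod>l\<leftarrow>[0..<p]. r j l ^ (k ! l)) = (\<Prod>l<p. r j l ^ (k ! l))"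
    by (subst prod.distinct_set_conv_list[symmetric]) (simp_all add: atLeast0LessThan)
  then show ?thesis
    by (simp add: power_prod_tm_def result_for_each elementary_tm_defs fold_mult_eq)
qed

lemma result_power_prod_tm_counts:
  assumes "set xs \<subseteq> {..<p}"
  shows "result (power_prod_tm p r j (cell_counts p xs)) = (\<Prod>l\<leftarrow>xs. r j l)"
  unfolding result_power_prod_tm prod_list_eq_power_count[OF assms]
  by (rule prod.cong) (simp_all add: cell_counts_def)

text \<open>Different keys may interleave and one key may occur often, yet entry \<open>k\<close>
  collects just the contributions addressed to it. This relies on \<open>v\<close> being independent
  of the table under construction: the algorithm reads its factors from the previous table
  only.\<close>

lemma fold_accumulate:
  fixes T :: table
  shows "the (fold (\<lambda>x T. T(key x \<mapsto> the (T (key x)) + v x)) xs T k)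
           = the (T k) + (\<Sum>x\<leftarrow>filter (\<lambda>x. key x = k) xs. v x)"
  by (induction xs arbitrary: T) simp_all

lemma fold_accumulate_nested:
  fixes T :: table
  shows "the (fold (\<lambda>j. fold (\<lambda>x T. T(key j x \<mapsto> the (T (key j x)) + v j x)) xs) js T k)
           = the (T k) + (\<Sum>j\<leftarrow>js. \<Sum>x\<leftarrow>filter (\<lambda>x. key j x = k) xs. v j x)"
  by (induction js arbitrary: T) (simp_all add: fold_accumulate add.assoc)

lemma result_next_table_tm:
  assumes "length k = p" "sum_list k = Suc i"
  shows "the (result (next_table_tm p W r (Suc i) T) k)
           = (\<Sum>j<p. \<Sum>k' | length k' = p \<and> sum_list k' = i \<and> k'[j := k' ! j + 1] = k.
                the (T k') * W j * result (power_prod_tm p r j k'))"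
proof -
  let ?v = "\<lambda>j k'. the (T k') * W j * result (power_prod_tm p r j k')"
  have inner: "(\<Sum>k'\<leftarrow>filter (\<lambda>k'. k'[j := k' ! j + 1] = k) (result (vectors_tm p i)). ?v j k')
      = (\<Sum>k' | length k' = p \<and> sum_list k' = i \<and> k'[j := k' ! j + 1] = k. ?v j k')" for j
    by (subst sum.distinct_set_conv_list[symmetric])
      (auto simp: distinct_vectors_tm set_vectors_tm intro!: sum.cong)
  show ?thesis
    using read_result_zero_table_tm[OF assms]
    by (simp add: next_table_tm_def result_for_each elementary_tm_defs
        fold_accumulate_nested[of "\<lambda>j k'. k'[j := Suc (k' ! j)]", simplified] inner[simplified]
        interv_sum_list_conv_sum_set_nat atLeast0LessThan)
qed

text \<open>The loop invariant: an entry is the total weight of the sequences with these counts. It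
  is confined to indices of length \<open>p\<close> and sum \<open>i\<close>, the only ones
  initialised; elsewhere \<open>the\<close> may be applied to \<open>None\<close>.\<close>

definition table_correct ::
    "nat \<Rightarrow> (nat \<Rightarrow> real) \<Rightarrow> (nat \<Rightarrow> nat \<Rightarrow> real) \<Rightarrow> nat \<Rightarrow> table \<Rightarrow> bool" where
  "table_correct p W r i T \<longleftrightarrow> (\<forall>k. length k = p \<and> sum_list k = i \<longrightarrow>
     the (T k) = (\<Sum>xs | xs \<in> cell_seqs p i \<and> cell_counts p xs = k. seq_weight W r xs))"

text \<open>Splitting off the newest cell \<open>j\<close> turns a sequence for \<open>Suc i\<close>
  into one for \<open>i\<close>. Its extra factor depends on the tail only through the tail's
  counts, so it is constant on each group stored in one old entry.\<close>

lemma table_correct_next: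
  assumes "table_correct p W r i T"
  shows "table_correct p W r (Suc i) (result (next_table_tm p W r (Suc i) T))"
  unfolding table_correct_def
proof (intro allI impI; elim conjE)
  fix k :: "nat list"
  assume k: "length k = p" "sum_list k = Suc i"
  let ?K = "\<lambda>j. {k'. length k' = p \<and> sum_list k' = i \<and> k'[j := k' ! j + 1] = k}"
  let ?X = "\<lambda>j. {xs \<in> cell_seqs p i. cell_counts p (j # xs) = k}"
  have fin: "finite (?K j)" for j
    by (rule finite_subset[OF _ finite_vectors[of p i]]) auto
  have "(\<Sum>k'\<in>?K j. the (T k') * W j * result (power_prod_tm p r j k'))
          = (\<Sum>xs\<in>?X j. seq_weight W r (j # xs))" if "j < p" for j
  proof -
    have "(\<Sum>k'\<in>?K j. the (T k') * W j * result (power_prod_tm p r j k'))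
        = (\<Sum>k'\<in>?K j. \<Sum>xs | xs \<in> ?X j \<and> cell_counts p xs = k'. seq_weight W r (j # xs))"
    proof (rule sum.cong)
      fix k' assume k': "k' \<in> ?K j"
      \<comment> \<open>Inside \<open>?K j\<close>, a tail with counts \<open>k'\<close>
        automatically leads to \<open>k\<close>, so the extra condition in \<open>?X j\<close> may
        be added.\<close>
      then have eq: "{xs \<in> cell_seqs p i. cell_counts p xs = k'}
          = {xs. xs \<in> ?X j \<and> cell_counts p xs = k'}"
        using that by (auto simp: cell_counts_Cons)
      have "the (T k') = (\<Sum>xs | xs \<in> cell_seqs p i \<and> cell_counts p xs = k'. seq_weight W r xs)"
        using assms k' unfolding table_correct_def by blast
      then show "the (T k') * W j * result (power_prod_tm p r j k')
          = (\<Sum>xs | xs \<in> ?X j \<and> cell_counts p xs = k'. seq_weight W r (j # xs))"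
        unfolding eq[symmetric]
        by (auto simp: sum_distrib_right cell_seqs_def result_power_prod_tm_counts intro!: sum.cong)
    qed simp
    \<comment> \<open>The counts of every tail in \<open>?X j\<close> lie in \<open>?K j\<close>, so
      the groups indexed by \<open>k'\<close> cover \<open>?X j\<close>.\<close>
    also have "\<dots> = (\<Sum>xs\<in>?X j. seq_weight W r (j # xs))"
      by (rule sum.group)
        (use fin that in \<open>auto simp: cell_counts_Cons sum_list_cell_counts cell_seqs_def
          intro: finite_subset[OF _ finite_cell_seqs[of p i]]\<close>)
    finally show ?thesis .
  qed
  then have "the (result (next_table_tm p W r (Suc i) T) k)
      = (\<Sum>j<p. \<Sum>xs\<in>?X j. seq_weight W r (j # xs))"
    unfolding result_next_table_tm[OF k] by (intro sum.cong[OF refl]) simp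
  also have "\<dots> = (\<Sum>(j, xs)\<in>(SIGMA j:{..<p}. ?X j). seq_weight W r (j # xs))"
    by (rule sum.Sigma) auto
  also have "\<dots> = (\<Sum>xs | xs \<in> cell_seqs p (Suc i) \<and> cell_counts p xs = k. seq_weight W r xs)"
    by (rule sum.reindex_bij_witness[of _ "\<lambda>xs. (hd xs, tl xs)" "\<lambda>(j, xs). j # xs"])
      (auto simp: cell_seqs_Suc)
  finally show "the (result (next_table_tm p W r (Suc i) T) k)
      = (\<Sum>xs | xs \<in> cell_seqs p (Suc i) \<and> cell_counts p xs = k. seq_weight W r xs)" .
qed

lemma unit_vector_iff:
  "(replicate p 0)[j := 1] = (replicate p 0)[j' := (1::nat)] \<longleftrightarrow> j = j'" if "j < p" "j' < p"
proof
  assume "(replicate p 0)[j := 1] = (replicate p 0)[j' := (1::nat)]"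
  then have "(replicate p 0)[j := 1] ! j = (replicate p 0)[j' := (1::nat)] ! j"
    by simp
  then show "j = j'"
    using that by (simp add: nth_list_update split: if_splits)
qed simp

lemma cell_counts_single: "j < p \<Longrightarrow> cell_counts p [j] = (replicate p 0)[j := 1]"
  by (rule nth_equalityI) (auto simp: cell_counts_def nth_list_update)

lemma table_correct_first: "table_correct p W r 1 (result (first_table_tm p W))"
  unfolding table_correct_def
proof (intro allI impI; elim conjE)
  fix k :: "nat list"
  assume k: "length k = p" "sum_list k = 1"
  define d :: "nat \<Rightarrow> nat list" where "d = (\<lambda>j. (replicate p 0)[j := 1])"
  have keep: "fold (\<lambda>j T. T(d j \<mapsto> W j)) js T k = T k"
    if "\<forall>j\<in>set js. d j \<noteq> k" for js and T :: table
    using that by (induction js arbitrary: T) auto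
  have "\<exists>j<p. k = d j"
  proof -
    obtain j where j: "j < p" "k ! j \<noteq> 0"
      using k by (metis gr_implies_not0 in_set_conv_nth member_le_sum_list sum_list_eq_0_iff zero_neq_one)
    \<comment> \<open>The entry at \<open>j\<close> is nonzero and the total is 1, so nothing is
      left for the entries on either side: \<open>k\<close> is a unit vector.\<close>
    have eq: "k ! j + sum_list (take j k) + sum_list (drop (Suc j) k) = 1"
      using k j by (subst (asm) id_take_nth_drop[of j]) auto
    then have "sum_list (take j k) = 0" "sum_list (drop (Suc j) k) = 0" "k ! j = 1"
      using j by linarith+
    then have "\<forall>x\<in>set (take j k). x = 0" "\<forall>x\<in>set (drop (Suc j) k). x = 0"
      by (simp_all only: sum_list_eq_0_iff)
    then have "take j k = replicate j 0" "drop (Suc j) k = replicate (p - Suc j) 0"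
      using j k by (auto intro: replicate_eqI)
    then have "k = replicate j 0 @ 1 # replicate (p - Suc j) 0"
      using \<open>k ! j = 1\<close> j k by (metis id_take_nth_drop)
    then have "k = d j"
      using j by (simp add: d_def upd_conv_take_nth_drop)
    then show ?thesis using j by blast
  qed
  then obtain j where j: "j < p" "k = d j"
    by blast
  \<comment> \<open>The loop is cut at the write to \<open>k\<close>. Later writes go to other unit
    vectors, so this value survives, and whatever was there before is irrelevant.\<close>
  have split: "[0..<p] = [0..<j] @ j # [Suc j..<p]"
    using j by (metis upt_add_eq_append less_imp_add_positive upt_conv_Cons le0 le_add_same_cancel1 less_or_eq_imp_le)
  have "result (first_table_tm p W)
      = fold (\<lambda>j T. T(d j \<mapsto> W j)) [0..<p] (result (zero_table_tm p 1))"
    by (simp add: first_table_tm_def result_for_each elementary_tm_defs d_def)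
  moreover have "d j' = k \<longleftrightarrow> j' = j" if "j' < p" for j'
    using that j by (simp only: d_def unit_vector_iff)
  then have "\<forall>j'\<in>set [Suc j..<p]. d j' \<noteq> k"
    by auto
  then have "fold (\<lambda>j T. T(d j \<mapsto> W j)) [Suc j..<p] T k = T k" for T
    by (rule keep)
  ultimately have "the (result (first_table_tm p W) k) = W j"
    using j by (simp only: split fold_append fold.simps o_apply fun_upd_same option.sel)
  moreover have "{xs \<in> cell_seqs p 1. cell_counts p xs = k} = {[j]}"
    using j unit_vector_iff[of _ p j]
    by (auto simp: cell_seqs_def length_Suc_conv cell_counts_single d_def)
  ultimately show "the (result (first_table_tm p W) k)
      = (\<Sum>xs | xs \<in> cell_seqs p 1 \<and> cell_counts p xs = k. seq_weight W r xs)"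
    by simp
qed

lemma fold_add_eq: "fold (\<lambda>k s. s + g k) ks (a::real) = a + (\<Sum>k\<leftarrow>ks. g k)"
  by (induction ks arbitrary: a) (simp_all add: algebra_simps)

lemma result_incremental_wfomc:
  assumes "n \<ge> 1"
  shows "result (incremental_wfomc p W r n) = (\<Sum>xs\<in>cell_seqs p n. seq_weight W r xs)"
proof -
  define T where
    "T = fold (\<lambda>i T. result (next_table_tm p W r i T)) [2..<Suc n] (result (first_table_tm p W))"
  \<comment> \<open>The induction starts at 1, where the range \<open>[2..<2]\<close> is empty and
    \<open>T\<close> is the first table.\<close>
  have T: "table_correct p W r n T"
    using assms unfolding T_def
  proof (induction n rule: dec_induct)
    case base
    show ?case using table_correct_first[of p W r] by simp
  next
    case (step m)
    then have "[2..<Suc (Suc m)] = [2..<Suc m] @ [Suc m]" by simp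
    with step show ?case by (simp add: table_correct_next del: upt_Suc)
  qed
  let ?V = "{k. length k = p \<and> sum_list k = n}"
  have "result (incremental_wfomc p W r n) = (\<Sum>k\<leftarrow>result (vectors_tm p n). the (T k))"
    by (simp add: incremental_wfomc_def result_for_each elementary_tm_defs T_def fold_add_eq
        del: upt_Suc)
  also have "\<dots> = (\<Sum>k\<in>?V. the (T k))"
    by (subst sum.distinct_set_conv_list[symmetric]) (simp_all add: distinct_vectors_tm set_vectors_tm)
  also have "\<dots> = (\<Sum>k\<in>?V. \<Sum>xs | xs \<in> cell_seqs p n \<and> cell_counts p xs = k. seq_weight W r xs)"
    using T by (intro sum.cong) (auto simp: table_correct_def)
  also have "\<dots> = (\<Sum>xs\<in>cell_seqs p n. seq_weight W r xs)"
    by (rule sum.group) (auto simp: cell_seqs_def sum_list_cell_counts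
      intro: finite_cell_seqs[unfolded cell_seqs_def])
  finally show ?thesis .
qed

section \<open>Polynomial bounds on the number of steps\<close>

lemma steps_zero_table_tm_le: "steps (zero_table_tm p i) \<le> (3 * p + 3) * Suc i ^ p"
proof -
  let ?ks = "result (vectors_tm p i)"
  have "steps (for_each ?ks (\<lambda>k T. write_tm T k 0) Map.empty) \<le> length ?ks * Suc (Suc p)"
    by (rule steps_for_each_le) (simp add: elementary_tm_defs set_vectors_tm)
  also have "\<dots> \<le> Suc i ^ p * Suc (Suc p)"
    by (intro mult_right_mono length_vectors_tm_le) simp
  \<comment> \<open>\<open>3 * p + 3\<close> is \<open>2 * p + 1\<close> for the enumeration plus
    \<open>p + 2\<close> for each write with its iteration charge.\<close>
  finally show ?thesis
    using steps_vectors_tm_le[of p i] by (simp add: zero_table_tm_def algebra_simps)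
qed

text \<open>One factor costs at most \<open>p\<close> for reading the entry, \<open>n + 1\<close>
  for the power, 1 for the multiplication and 1 for the iteration.\<close>

lemma steps_power_prod_tm_le:
  assumes "length k = p" "sum_list k \<le> n"
  shows "steps (power_prod_tm p r j k) \<le> p * (p + n + 3)"
proof -
  have "steps (power_prod_tm p r j k) \<le> length [0..<p] * Suc (p + n + 2)"
    unfolding power_prod_tm_def
  proof (rule steps_for_each_le)
    fix l and s :: real
    assume "l \<in> set [0..<p]"
    then have "k ! l \<le> n" "Suc l \<le> p"
      using assms elem_le_sum_list[of l k] by auto
    then show "steps (do { e \<leftarrow> entry_tm k l; x \<leftarrow> power_tm (r j l) e; mult_tm s x }) \<le> p + n + 2"
      by (simp add: elementary_tm_defs)
  qed
  then show ?thesis by (simp add: algebra_simps)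
qed

lemma steps_next_table_tm_le:
  assumes "i \<le> n"
  shows "steps (next_table_tm p W r i T)
    \<le> (3 * p + 3) * Suc n ^ p + p * Suc ((2 * p + 1) * Suc n ^ p
        + Suc n ^ p * (4 * p + 8 + p * (p + n + 3)))"
proof -
  \<comment> \<open>Four operations of cost \<open>p + 1\<close> (two reads, one index update, one
    write) and three of cost 1 give \<open>4 * p + 7\<close>; the rest is the product of
    powers.\<close>
  let ?c = "4 * p + 7 + p * (p + n + 3)"
  have pow: "Suc m ^ p \<le> Suc n ^ p" if "m \<le> n" for m
    using that by (intro power_mono) simp_all
  have zero: "steps (zero_table_tm p i) \<le> (3 * p + 3) * Suc n ^ p"
    using steps_zero_table_tm_le mult_left_mono[OF pow[OF assms], of "3 * p + 3"]
    by (meson le0 order_trans)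
  have vec: "steps (vectors_tm p (i - 1)) \<le> (2 * p + 1) * Suc n ^ p"
    using steps_vectors_tm_le mult_left_mono[OF pow[of "i - 1"], of "2 * p + 1"] assms
    by (meson le0 order_trans diff_le_self)
  have len: "length (result (vectors_tm p (i - 1))) * Suc ?c \<le> Suc n ^ p * Suc ?c"
    using length_vectors_tm_le pow[of "i - 1"] assms
    by (intro mult_right_mono) (meson order_trans diff_le_self, simp)
  have body: "4 * p + 7 + p * (p + n + 3) \<ge> steps (do {
               t \<leftarrow> read_tm T kold;
               tw \<leftarrow> mult_tm t (W j);
               q \<leftarrow> power_prod_tm p r j kold;
               x \<leftarrow> mult_tm tw q;
               knew \<leftarrow> add_unit_tm kold j;
               y \<leftarrow> read_tm T' knew;
               z \<leftarrow> add_tm y x;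
               write_tm T' knew z })"
    if "kold \<in> set (result (vectors_tm p (i - 1)))" for kold j T'
  proof -
    have *: "length kold = p" "sum_list kold \<le> n"
      using that assms by (auto simp: set_vectors_tm)
    show ?thesis
      using steps_power_prod_tm_le[OF *, of r j] * by (simp add: elementary_tm_defs)
  qed
  have "steps (next_table_tm p W r i T) \<le> steps (zero_table_tm p i)
      + length [0..<p] * Suc ((2 * p + 1) * Suc n ^ p + Suc n ^ p * Suc ?c)"
    unfolding next_table_tm_def steps_bind_tm
    by (intro add_left_mono steps_for_each_le)
      (simp only: steps_bind_tm, intro add_mono vec order_trans[OF _ len] steps_for_each_le body)
  with zero show ?thesis
    by (simp add: algebra_simps)
qed

lemma steps_incremental_wfomc_poly:
  "\<exists>q :: nat poly. \<forall>n\<ge>1. steps (incremental_wfomc p W r n) \<le> poly q n"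
proof -
  \<comment> \<open>\<open>s\<close> is \<open>(n + 1) ^ p\<close> and \<open>t\<close> bounds one
    round. \<open>q\<close> adds up the first table (where \<open>Suc 1 ^ p\<close> yields
    \<open>2 ^ p\<close>), at most \<open>n\<close> rounds, the final enumeration and the final
    summation. Its degree is at most \<open>p + 2\<close>.\<close>
  define s :: "nat poly" where "s = [:1, 1:] ^ p"
  define t :: "nat poly" where
    "t = [:3 * p + 3:] * s + [:p:] * (1 + [:2 * p + 1:] * s
           + s * ([:4 * p + 8:] + [:p:] * [:p + 3, 1:]))"
  define q :: "nat poly" where
    "q = [:(3 * p + 3) * 2 ^ p + p * (2 * p + 4):] + [:0, 1:] * (1 + t) + [:2 * p + 1:] * s
           + s * [:p + 3:]"
  have s: "poly s n = Suc n ^ p" for n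
    by (simp add: s_def)
  have t: "poly t n = (3 * p + 3) * Suc n ^ p + p * Suc ((2 * p + 1) * Suc n ^ p
        + Suc n ^ p * (4 * p + 8 + p * (p + n + 3)))" for n
    by (simp add: t_def s algebra_simps)
  have "steps (incremental_wfomc p W r n) \<le> poly q n" if "n \<ge> 1" for n
  proof -
    have "steps (for_each [0..<p] (\<lambda>j T. do { d \<leftarrow> unit_tm p j; write_tm T d (W j) })
        (result (zero_table_tm p 1))) \<le> length [0..<p] * Suc (2 * p + 3)"
      by (rule steps_for_each_le) (simp add: elementary_tm_defs)
    also have "\<dots> = p * (2 * p + 4)"
      by simp
    finally have "steps (for_each [0..<p] (\<lambda>j T. do { d \<leftarrow> unit_tm p j; write_tm T d (W j) })
        (result (zero_table_tm p 1))) \<le> p * (2 * p + 4)" .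
    then have first: "steps (first_table_tm p W) \<le> (3 * p + 3) * 2 ^ p + p * (2 * p + 4)"
      unfolding first_table_tm_def steps_bind_tm
      by (intro add_mono steps_zero_table_tm_le[of p 1, unfolded Suc_1])
    have loop: "steps (for_each [2..<Suc n] (\<lambda>i T. next_table_tm p W r i T) T) \<le> n * Suc (poly t n)"
      for T
    proof -
      have "steps (for_each [2..<Suc n] (\<lambda>i T. next_table_tm p W r i T) T)
          \<le> length [2..<Suc n] * Suc (poly t n)"
        unfolding t by (intro steps_for_each_le steps_next_table_tm_le) auto
      also have "\<dots> \<le> n * Suc (poly t n)"
        by (intro mult_right_mono) auto
      finally show ?thesis .
    qed
    have out: "steps (for_each (result (vectors_tm p n)) (\<lambda>k s. do { t \<leftarrow> read_tm T k; add_tm s t }) 0)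
        \<le> Suc n ^ p * (p + 3)" for T
    proof -
      have "steps (for_each (result (vectors_tm p n)) (\<lambda>k s. do { t \<leftarrow> read_tm T k; add_tm s t }) 0)
          \<le> length (result (vectors_tm p n)) * Suc (p + 2)"
        by (rule steps_for_each_le) (simp add: elementary_tm_defs set_vectors_tm)
      also have "\<dots> \<le> Suc n ^ p * Suc (p + 2)"
        by (intro mult_right_mono length_vectors_tm_le) simp
      finally show ?thesis by (simp add: algebra_simps)
    qed
    have "steps (incremental_wfomc p W r n) \<le> ((3 * p + 3) * 2 ^ p + p * (2 * p + 4))
        + (n * Suc (poly t n) + ((2 * p + 1) * Suc n ^ p + Suc n ^ p * (p + 3)))"
      unfolding incremental_wfomc_def steps_bind_tm
      by (intro add_mono first loop steps_vectors_tm_le out)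
    also have "\<dots> = poly q n"
      by (simp add: q_def s)
    finally show ?thesis .
  qed
  then show ?thesis by blast
qed

section \<open>Propositional model counting\<close>

lemma sat_map_fm: "sat \<omega> (map_fm f F) \<longleftrightarrow> sat (f -` \<omega>) F"
  by (induction F) simp_all

lemma sat_cong: "\<omega> \<inter> set_fm F = \<omega>' \<inter> set_fm F \<Longrightarrow> sat \<omega> F \<longleftrightarrow> sat \<omega>' F"
proof (induction F)
  case (And F G)
  then have "\<omega> \<inter> set_fm F = \<omega>' \<inter> set_fm F" "\<omega> \<inter> set_fm G = \<omega>' \<inter> set_fm G" by auto
  with And.IH show ?case by simp
next
  case (Or F G)
  then have "\<omega> \<inter> set_fm F = \<omega>' \<inter> set_fm F" "\<omega> \<inter> set_fm G = \<omega>' \<inter> set_fm G" by auto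
  with Or.IH show ?case by simp
next
  case (Imp F G)
  then have "\<omega> \<inter> set_fm F = \<omega>' \<inter> set_fm F" "\<omega> \<inter> set_fm G = \<omega>' \<inter> set_fm G" by auto
  with Imp.IH show ?case by simp
qed auto

lemma sat_inst: "sat \<omega> (inst \<sigma> F) \<longleftrightarrow> sat (map_atom id \<sigma> -` \<omega>) F"
  by (simp add: inst_def sat_map_fm)

lemma set_fm_inst: "set_fm (inst \<sigma> F) = map_atom id \<sigma> ` set_fm F"
  by (simp add: inst_def fm.set_map)

lemma map_fm_inst: "map_fm (map_atom id \<tau>) (inst \<sigma> F) = inst (\<tau> \<circ> \<sigma>) F"
  by (simp add: inst_def fm.map_comp atom.map_comp comp_def id_def)

lemma map_fm_inst2: "map_fm (map_atom id \<tau>) (inst2 \<psi> a b) = inst2 \<psi> (\<tau> a) (\<tau> b)"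
proof -
  have "\<tau> \<circ> case_var a b = case_var (\<tau> a) (\<tau> b)"
    by (auto split: var.split)
  then show ?thesis
    by (simp add: inst2_def map_fm_inst)
qed

text \<open>A single product over \<open>V\<close> replaces the two products of \<open>wmc\<close>.
  It makes sense for worlds that are not subsets of \<open>V\<close>, so one and the same
  \<open>\<omega>\<close> can be weighed on every block of a partition.\<close>

definition world_weight :: "'a set \<Rightarrow> ('a \<Rightarrow> real) \<Rightarrow> ('a \<Rightarrow> real) \<Rightarrow> 'a set \<Rightarrow> real" where
  "world_weight V w wb \<omega> = (\<Prod>l\<in>V. if l \<in> \<omega> then w l else wb l)"

lemma world_weight_eq:
  assumes "finite V" "\<omega> \<subseteq> V"
  shows "(\<Prod>l\<in>\<omega>. w l) * (\<Prod>l\<in>V - \<omega>. wb l) = world_weight V w wb \<omega>"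
proof -
  have "V \<inter> {l. l \<in> \<omega>} = \<omega>" "V \<inter> - {l. l \<in> \<omega>} = V - \<omega>"
    using assms by auto
  then show ?thesis
    using assms by (simp add: world_weight_def prod.If_cases)
qed

lemma world_weight_cong:
  assumes "\<omega> \<inter> V = \<omega>' \<inter> V" "\<And>l. l \<in> V \<Longrightarrow> w l = w' l" "\<And>l. l \<in> V \<Longrightarrow> wb l = wb' l"
  shows "world_weight V w wb \<omega> = world_weight V w' wb' \<omega>'"
  unfolding world_weight_def using assms by (intro prod.cong) auto

lemma world_weight_Un:
  assumes "finite V" "finite V'" "V \<inter> V' = {}"
  shows "world_weight (V \<union> V') w wb \<omega> = world_weight V w wb \<omega> * world_weight V' w wb \<omega>"
  unfolding world_weight_def using assms by (rule prod.union_disjoint)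

lemma world_weight_UN:
  assumes "finite I" "\<And>i. i \<in> I \<Longrightarrow> finite (V i)"
    and "\<And>i j. i \<in> I \<Longrightarrow> j \<in> I \<Longrightarrow> i \<noteq> j \<Longrightarrow> V i \<inter> V j = {}"
  shows "world_weight (\<Union>i\<in>I. V i) w wb \<omega> = (\<Prod>i\<in>I. world_weight (V i) w wb \<omega>)"
  unfolding world_weight_def by (rule prod.UNION_disjoint) (use assms in auto)

lemma wmc_eq_world_weight:
  assumes "finite V"
  shows "wmc V \<Gamma> w wb = (\<Sum>\<omega> | \<omega> \<subseteq> V \<and> (\<forall>F\<in>\<Gamma>. sat \<omega> F). world_weight V w wb \<omega>)"
  unfolding wmc_def using assms by (intro sum.cong) (auto simp: world_weight_eq)

text \<open>Subsets of \<open>V\<close> correspond to subsets of its image. As \<open>f\<close> is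
  injective only on \<open>V\<close>, the preimage of an image can contain foreign atoms; the
  formulas do not see them because their atoms lie in \<open>V\<close>.\<close>

lemma wmc_image:
  assumes "finite V" "inj_on f V" "\<And>F. F \<in> \<Gamma> \<Longrightarrow> set_fm F \<subseteq> V"
  shows "wmc (f ` V) (map_fm f ` \<Gamma>) w wb = wmc V \<Gamma> (w \<circ> f) (wb \<circ> f)"
proof -
  have inv: "(f -` f ` \<omega>) \<inter> V = \<omega>" if "\<omega> \<subseteq> V" for \<omega>
    using that assms(2) by (auto dest: inj_onD)
  have sat: "sat (f ` \<omega>) (map_fm f F) \<longleftrightarrow> sat \<omega> F" if "\<omega> \<subseteq> V" "F \<in> \<Gamma>" for \<omega> F
    unfolding sat_map_fm
    by (rule sat_cong) (use inv[OF that(1)] assms(3)[OF that(2)] in blast)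
  have weight: "world_weight (f ` V) w wb (f ` \<omega>) = world_weight V (w \<circ> f) (wb \<circ> f) \<omega>"
    if "\<omega> \<subseteq> V" for \<omega>
    unfolding world_weight_def
    by (subst prod.reindex[OF assms(2)])
      (use that assms(2) in \<open>auto simp: inj_on_image_mem_iff intro!: prod.cong\<close>)
  have "(\<Sum>\<omega> | \<omega> \<subseteq> V \<and> (\<forall>F\<in>\<Gamma>. sat \<omega> F). world_weight V (w \<circ> f) (wb \<circ> f) \<omega>)
      = (\<Sum>\<omega> | \<omega> \<subseteq> f ` V \<and> (\<forall>F\<in>map_fm f ` \<Gamma>. sat \<omega> F). world_weight (f ` V) w wb \<omega>)"
  proof (rule sum.reindex_bij_witness[of _ "\<lambda>\<omega>. (f -` \<omega>) \<inter> V" "image f"])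
    fix \<omega> assume \<omega>: "\<omega> \<in> {\<omega>. \<omega> \<subseteq> f ` V \<and> (\<forall>F\<in>map_fm f ` \<Gamma>. sat \<omega> F)}"
    then show im: "f ` ((f -` \<omega>) \<inter> V) = \<omega>"
      by auto
    have "sat ((f -` \<omega>) \<inter> V) F" if "F \<in> \<Gamma>" for F
      using sat[OF _ that, of "(f -` \<omega>) \<inter> V"] \<omega> that im by auto
    then show "(f -` \<omega>) \<inter> V \<in> {\<omega>. \<omega> \<subseteq> V \<and> (\<forall>F\<in>\<Gamma>. sat \<omega> F)}"
      by auto
  qed (auto simp: inv sat weight)
  then show ?thesis
    using assms(1) by (simp add: wmc_eq_world_weight)
qed

lemma wmc_cong_weights:
  assumes "finite V" "\<And>l. l \<in> V \<Longrightarrow> w l = w' l" "\<And>l. l \<in> V \<Longrightarrow> wb l = wb' l"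
  shows "wmc V \<Gamma> w wb = wmc V \<Gamma> w' wb'"
  unfolding wmc_eq_world_weight[OF assms(1)]
  by (intro sum.cong refl world_weight_cong) (use assms in auto)

section \<open>Sums over worlds on disjoint sets of atoms\<close>

lemma sum_Pow_Un:
  assumes "V \<inter> V' = {}"
  shows "(\<Sum>\<omega>\<in>Pow (V \<union> V'). g \<omega>) = (\<Sum>u\<in>Pow V. \<Sum>x\<in>Pow V'. g (u \<union> x))"
  unfolding sum.cartesian_product
  by (rule sum.reindex_bij_witness[of _ "\<lambda>(u, x). u \<union> x" "\<lambda>\<omega>. (\<omega> \<inter> V, \<omega> \<inter> V')"])
    (use assms in \<open>auto simp: Int_Un_distrib2 simp flip: Int_Un_distrib intro: arg_cong[of _ _ g]\<close>)

text \<open>Distributivity: a subset of a disjoint union is an independent choice of one subset per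
  part, and the factor \<open>g i\<close> looks only at part \<open>i\<close>.\<close>

lemma sum_Pow_UN:
  fixes g :: "'i \<Rightarrow> 'a set \<Rightarrow> real"
  assumes "finite I"
    and "\<And>i j. i \<in> I \<Longrightarrow> j \<in> I \<Longrightarrow> i \<noteq> j \<Longrightarrow> V i \<inter> V j = {}"
  shows "(\<Sum>\<omega>\<in>Pow (\<Union>i\<in>I. V i). \<Prod>i\<in>I. g i (\<omega> \<inter> V i)) = (\<Prod>i\<in>I. \<Sum>\<omega>\<in>Pow (V i). g i \<omega>)"
  using assms
proof (induction I rule: finite_induct)
  case (insert i I)
  have disj: "V i \<inter> (\<Union>j\<in>I. V j) = {}"
    using insert.hyps insert.prems by blast
  have "(\<Sum>\<omega>\<in>Pow (\<Union>j\<in>insert i I. V j). \<Prod>j\<in>insert i I. g j (\<omega> \<inter> V j))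
      = (\<Sum>u\<in>Pow (V i). \<Sum>x\<in>Pow (\<Union>j\<in>I. V j). \<Prod>j\<in>insert i I. g j ((u \<union> x) \<inter> V j))"
    by (simp add: sum_Pow_Un[OF disj])
  also have "\<dots> = (\<Sum>u\<in>Pow (V i). \<Sum>x\<in>Pow (\<Union>j\<in>I. V j). g i u * (\<Prod>j\<in>I. g j (x \<inter> V j)))"
  proof (intro sum.cong refl)
    fix u x assume u: "u \<in> Pow (V i)" and x: "x \<in> Pow (\<Union>j\<in>I. V j)"
    have "(u \<union> x) \<inter> V i = u"
      using u x disj by blast
    moreover have "(u \<union> x) \<inter> V j = x \<inter> V j" if "j \<in> I" for j
      using u that disj by blast
    ultimately show "(\<Prod>j\<in>insert i I. g j ((u \<union> x) \<inter> V j)) = g i u * (\<Prod>j\<in>I. g j (x \<inter> V j))"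
      using insert.hyps by simp
  qed
  also have "\<dots> = (\<Sum>u\<in>Pow (V i). g i u) * (\<Prod>j\<in>I. \<Sum>\<omega>\<in>Pow (V j). g j \<omega>)"
    using insert.IH insert.prems by (simp flip: sum_distrib_left sum_distrib_right)
  finally show ?case
    using insert.hyps by simp
qed simp

section \<open>Ground atoms and their blocks\<close>

lemma finite_atoms_over:
  assumes "finite Ps" "finite D"
  shows "finite (atoms_over Ps ar D)"
proof -
  have "atoms_over Ps ar D
      \<subseteq> (\<Union>P\<in>Ps. Atom P ` {ts. set ts \<subseteq> D \<and> length ts = ar P})"
    by (auto simp: atoms_over_def)
  moreover have "finite \<dots>"
    using assms by (auto intro: finite_lists_length_eq)
  ultimately show ?thesis
    by (rule finite_subset)
qed

lemma atoms_over_iff: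
  "l \<in> atoms_over Ps ar D \<longleftrightarrow> pred l \<in> Ps \<and> length (args l) = ar (pred l) \<and> set (args l) \<subseteq> D"
  by (cases l) (auto simp: atoms_over_def)

lemma atoms_over_image: "atoms_over Ps ar (\<sigma> ` D) = map_atom id \<sigma> ` atoms_over Ps ar D"
proof (intro subset_antisym subsetI)
  fix l assume l: "l \<in> atoms_over Ps ar (\<sigma> ` D)"
  then have "args l \<in> lists (\<sigma> ` D)"
    by (auto simp: atoms_over_iff)
  then obtain ts where "ts \<in> lists D" "args l = map \<sigma> ts"
    by (auto simp: lists_image)
  with l show "l \<in> map_atom id \<sigma> ` atoms_over Ps ar D"
    by (intro image_eqI[of _ _ "Atom (pred l) ts"]) (cases l; auto simp: atoms_over_iff)+
qed (force simp: atoms_over_def)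

lemma inj_on_map_atom:
  assumes "inj_on \<sigma> D"
  shows "inj_on (map_atom id \<sigma>) (atoms_over Ps ar D)"
proof (rule inj_onI)
  fix l l' assume l: "l \<in> atoms_over Ps ar D" "l' \<in> atoms_over Ps ar D"
    and eq: "map_atom id \<sigma> l = map_atom id \<sigma> l'"
  obtain P ts P' ts' where l_eq: "l = Atom P ts" "l' = Atom P' ts'"
    by (meson atom.exhaust)
  with l eq have "map \<sigma> ts = map \<sigma> ts'" "inj_on \<sigma> (set ts \<union> set ts')"
    by (auto simp: atoms_over_def intro: inj_on_subset[OF assms])
  then have "ts = ts'"
    by (rule map_inj_on)
  with eq l_eq show "l = l'"
    by simp
qed

text \<open>Asking for equality with \<open>S\<close>, not inclusion, makes blocks of different sets
  disjoint. As \<open>S\<close> is unordered, the block of \<open>{a, b}\<close> holds both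
  \<open>R(a,b)\<close> and \<open>R(b,a)\<close>.\<close>

definition atom_block :: "'p set \<Rightarrow> ('p \<Rightarrow> nat) \<Rightarrow> 't set \<Rightarrow> ('p, 't) atom set" where
  "atom_block Ps ar S = {l. pred l \<in> Ps \<and> length (args l) = ar (pred l) \<and> set (args l) = S}"

lemma atom_block_disjoint: "S \<noteq> S' \<Longrightarrow> atom_block Ps ar S \<inter> atom_block Ps ar S' = {}"
  by (auto simp: atom_block_def)

section \<open>Cell assignments and cell sequences\<close>

definition ordered_pairs :: "nat \<Rightarrow> (nat \<times> nat) set" where
  "ordered_pairs n = {(a, b). 1 \<le> a \<and> a < b \<and> b \<le> n}"

lemma finite_ordered_pairs [simp]: "finite (ordered_pairs n)"
  by (rule finite_subset[of _ "{1..n} \<times> {1..n}"]) (auto simp: ordered_pairs_def)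

text \<open>The reversed interval has the newest constant at its head. Its factors are those of the
  pairs with larger component \<open>Suc n\<close>, so each pair is charged when its later element
  arrives, and the later cell is the first index of \<open>r\<close>.\<close>

lemma seq_weight_map:
  "seq_weight W r (map f (rev [1..<Suc n]))
     = (\<Prod>a\<in>{1..n}. W (f a)) * (\<Prod>(a, b)\<in>ordered_pairs n. r (f b) (f a))"
proof (induction n)
  case 0
  have "ordered_pairs 0 = {}"
    by (auto simp: ordered_pairs_def)
  then show ?case by simp
next
  case (Suc n)
  have pairs: "ordered_pairs (Suc n) = ordered_pairs n \<union> (\<lambda>a. (a, Suc n)) ` {1..n}"
    by (auto simp: ordered_pairs_def)
  have "(\<Prod>(a, b)\<in>ordered_pairs (Suc n). r (f b) (f a))
      = (\<Prod>(a, b)\<in>ordered_pairs n. r (f b) (f a))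
        * (\<Prod>(a, b)\<in>(\<lambda>a. (a, Suc n)) ` {1..n}. r (f b) (f a))"
    unfolding pairs
    by (rule prod.union_disjoint[OF finite_ordered_pairs]) (auto simp: ordered_pairs_def)
  also have "(\<Prod>(a, b)\<in>(\<lambda>a. (a, Suc n)) ` {1..n}. r (f b) (f a)) = (\<Prod>a\<in>{1..n}. r (f (Suc n)) (f a))"
    by (subst prod.reindex) (auto simp: inj_on_def)
  also have "\<dots> = (\<Prod>l\<leftarrow>map f (rev [1..<Suc n]). r (f (Suc n)) l)"
    using prod.distinct_set_conv_list[of "rev [1..<Suc n]" "\<lambda>a. r (f (Suc n)) (f a)"]
    by (simp only: distinct_rev distinct_upt set_rev set_upt atLeastLessThanSuc_atLeastAtMost
        map_map comp_def)
  finally have pairs_prod: "(\<Prod>(a, b)\<in>ordered_pairs (Suc n). r (f b) (f a))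
      = (\<Prod>(a, b)\<in>ordered_pairs n. r (f b) (f a))
        * (\<Prod>l\<leftarrow>map f (rev [1..<Suc n]). r (f (Suc n)) l)" .
  have "map f (rev [1..<Suc (Suc n)]) = f (Suc n) # map f (rev [1..<Suc n])"
    by simp
  then show ?case
    unfolding pairs_prod by (simp only: seq_weight.simps Suc) (simp add: algebra_simps)
qed

lemma sum_functions_eq_sum_seqs:
  "(\<Sum>f\<in>{1..n} \<rightarrow>\<^sub>E {..<p}.
      (\<Prod>a\<in>{1..n}. W (f a)) * (\<Prod>(a, b)\<in>ordered_pairs n. r (f b) (f a)))
    = (\<Sum>xs\<in>cell_seqs p n. seq_weight W r xs)"
\<comment> \<open>In a list headed by constant \<open>n\<close>, constant \<open>a\<close> sits at
  position \<open>n - a\<close>. Restriction makes the recovered function extensional.\<close>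
proof (rule sum.reindex_bij_witness[of _ "\<lambda>xs. restrict (\<lambda>a. xs ! (n - a)) {1..n}"
      "\<lambda>f. map f (rev [1..<Suc n])"])
  have rev_upt: "rev [1..<Suc n] ! k = n - k" if "k < n" for k
    using that by (simp add: rev_nth del: upt_Suc)
  show "restrict (\<lambda>a. map f (rev [1..<Suc n]) ! (n - a)) {1..n} = f"
    if f: "f \<in> {1..n} \<rightarrow>\<^sub>E {..<p}" for f
  proof (rule ext)
    fix a
    show "restrict (\<lambda>a. map f (rev [1..<Suc n]) ! (n - a)) {1..n} a = f a"
    proof (cases "a \<in> {1..n}")
      case True
      then have "map f (rev [1..<Suc n]) ! (n - a) = f (rev [1..<Suc n] ! (n - a))"
        by (intro nth_map) auto
      also have "rev [1..<Suc n] ! (n - a) = n - (n - a)"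
        by (rule rev_upt) (use True in auto)
      finally show ?thesis
        using True by simp
    next
      case False
      with PiE_arb[OF f False] show ?thesis
        by (simp only: restrict_def if_False)
    qed
  qed
  show "map f (rev [1..<Suc n]) \<in> cell_seqs p n" if "f \<in> {1..n} \<rightarrow>\<^sub>E {..<p}" for f
    using that by (auto simp: cell_seqs_def PiE_iff simp del: upt_Suc)
  show "map (restrict (\<lambda>a. xs ! (n - a)) {1..n}) (rev [1..<Suc n]) = xs"
    if "xs \<in> cell_seqs p n" for xs
  proof (rule nth_equalityI)
    have len: "length xs = n"
      using that by (simp add: cell_seqs_def)
    then show "length (map (restrict (\<lambda>a. xs ! (n - a)) {1..n}) (rev [1..<Suc n])) = length xs"
      by simp
    fix k assume "k < length (map (restrict (\<lambda>a. xs ! (n - a)) {1..n}) (rev [1..<Suc n]))"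
    then have k: "k < n"
      by (simp del: upt_Suc)
    then have "map (restrict (\<lambda>a. xs ! (n - a)) {1..n}) (rev [1..<Suc n]) ! k
        = restrict (\<lambda>a. xs ! (n - a)) {1..n} (rev [1..<Suc n] ! k)"
      by (intro nth_map) simp
    also have "\<dots> = xs ! k"
      proof -
      have "n - k \<in> {1..n}"
        using k by auto
      then show ?thesis
        unfolding rev_upt[OF k] using k by simp
    qed
    finally show "map (restrict (\<lambda>a. xs ! (n - a)) {1..n}) (rev [1..<Suc n]) ! k = xs ! k" .
  qed
  show "restrict (\<lambda>a. xs ! (n - a)) {1..n} \<in> {1..n} \<rightarrow>\<^sub>E {..<p}" if "xs \<in> cell_seqs p n" for xs
  proof (rule restrict_PiE_iff[THEN iffD2], rule ballI)
    fix a assume "a \<in> {1..n}"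
    then have "xs ! (n - a) \<in> set xs"
      using that by (intro nth_mem) (auto simp: cell_seqs_def)
    then show "xs ! (n - a) \<in> {..<p}"
      using that by (auto simp: cell_seqs_def)
  qed
  show "seq_weight W r (map f (rev [1..<Suc n]))
      = (\<Prod>a\<in>{1..n}. W (f a)) * (\<Prod>(a, b)\<in>ordered_pairs n. r (f b) (f a))" for f
    by (rule seq_weight_map)
qed

text \<open>A conjunction of local conditions becomes a product of 0/1 factors, which lets
  constraints be distributed over blocks together with the weights.\<close>

lemma prod_of_bool_mult:
  fixes x :: "'i \<Rightarrow> real"
  assumes "finite I"
  shows "(\<Prod>i\<in>I. of_bool (Q i) * x i) = of_bool (\<forall>i\<in>I. Q i) * (\<Prod>i\<in>I. x i)"
  using assms by (induction I rule: finite_induct) auto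

lemma sum_filter_eq_sum_of_bool:
  fixes g :: "'a \<Rightarrow> real"
  assumes "finite S"
  shows "(\<Sum>x | x \<in> S \<and> Q x. g x) = (\<Sum>x\<in>S. of_bool (Q x) * g x)"
  using assms by (intro sum.mono_neutral_cong_left) auto

section \<open>Factorisation of the ordered model count\<close>

locale ordered_fo2 =
  fixes Ps :: "'p set" and ar :: "'p \<Rightarrow> nat" and le :: 'p
    and \<psi> :: "('p, var) atom fm" and w wb :: "'p \<Rightarrow> real"
  assumes fin: "finite Ps"
    and arity: "\<And>P. P \<in> Ps \<Longrightarrow> ar P = 1 \<or> ar P = 2"
    and le_in: "le \<in> Ps" and ar_le: "ar le = 2"
    and vocab: "set_fm \<psi> \<subseteq> atoms_over Ps ar UNIV"
begin

abbreviation "HB D \<equiv> atoms_over Ps ar D"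
abbreviation "block S \<equiv> atom_block Ps ar S"
abbreviation "is_valid \<equiv> valid_cell Ps ar le \<psi>"
abbreviation "weight V \<equiv> world_weight V (w \<circ> pred) (wb \<circ> pred)"

lemma finite_HB [simp]: "finite D \<Longrightarrow> finite (HB D)"
  using fin by (rule finite_atoms_over)

lemma block_subset: "S \<subseteq> D \<Longrightarrow> block S \<subseteq> HB D"
  by (auto simp: atoms_over_iff atom_block_def)

lemma finite_block [simp]: "finite S \<Longrightarrow> finite (block S)"
  by (rule finite_subset[OF block_subset finite_HB]) simp_all

text \<open>This is where arity 1 or 2 enters: an argument list of such a length has one or two
  different constants.\<close>

lemma HB_cases:
  assumes "l \<in> HB D"
  obtains a where "a \<in> D" "l \<in> block {a}"
  | a b where "a \<in> D" "b \<in> D" "a \<noteq> b" "l \<in> block {a, b}"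
proof -
  have l: "pred l \<in> Ps" "length (args l) = ar (pred l)" "set (args l) \<subseteq> D"
    using assms by (auto simp: atoms_over_iff)
  show thesis
    using arity[OF l(1)]
  proof
    assume "ar (pred l) = 1"
    with l obtain a where "args l = [a]"
      by (auto simp: length_Suc_conv)
    with l show thesis
      by (intro that(1)[of a]) (auto simp: atom_block_def)
  next
    assume "ar (pred l) = 2"
    with l obtain a b where "args l = [a, b]"
      by (auto simp: length_Suc_conv numeral_2_eq_2)
    with l show thesis
      by (cases "a = b") (auto simp: atom_block_def intro: that)
  qed
qed

lemma HB_single: "HB {a} = block {a}"
proof (intro subset_antisym block_subset subsetI)
  fix l assume "l \<in> HB {a}"
  then show "l \<in> block {a}" by (cases rule: HB_cases) auto
qed simp

lemma HB_pair: "HB {a, b} = (block {a} \<union> block {b}) \<union> block {a, b}"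
proof (intro subset_antisym Un_least block_subset subsetI)
  fix l assume "l \<in> HB {a, b}"
  then show "l \<in> (block {a} \<union> block {b}) \<union> block {a, b}"
    by (cases rule: HB_cases) (auto simp: insert_commute)
qed simp_all

lemma HB_interval:
  "HB {1..n} = (\<Union>a\<in>{1..n}. block {a}) \<union> (\<Union>(a, b)\<in>ordered_pairs n. block {a, b})"
proof (intro subset_antisym Un_least UN_least subsetI)
  fix l assume "l \<in> HB {1..n}"
  then show "l \<in> (\<Union>a\<in>{1..n}. block {a}) \<union> (\<Union>(a, b)\<in>ordered_pairs n. block {a, b})"
  proof (cases rule: HB_cases)
    case (2 a b)
    have "l \<in> block {min a b, max a b}" "(min a b, max a b) \<in> ordered_pairs n"
      using 2 by (auto simp: ordered_pairs_def min_def max_def insert_commute)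
    then show ?thesis by blast
  qed blast
qed (auto simp: ordered_pairs_def atoms_over_iff atom_block_def)

lemma set_fm_inst2: "set_fm (inst2 \<psi> a b) \<subseteq> HB {a, b}"
proof -
  have "set_fm (inst2 \<psi> a b) \<subseteq> map_atom id (case_var a b) ` HB UNIV"
    unfolding inst2_def set_fm_inst using vocab by blast
  also have "\<dots> = HB (range (case_var a b))"
    by (rule atoms_over_image[symmetric])
  also have "range (case_var a b) \<subseteq> {a, b}"
    by (auto split: var.split)
  then have "HB (range (case_var a b)) \<subseteq> HB {a, b}"
    unfolding atoms_over_iff subset_iff by blast
  finally show ?thesis .
qed

section \<open>Cells as truth assignments to the atoms of one constant\<close>

definition cell_world :: "('p, var) atom fm set \<Rightarrow> 'c \<Rightarrow> ('p, 'c) atom set" where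
  "cell_world c a = map_atom id (\<lambda>_. a) ` {l. Atm l \<in> c}"

definition cell_of :: "('p, var) atom set \<Rightarrow> ('p, var) atom fm set" where
  "cell_of t = Atm ` t \<union> (Neg \<circ> Atm) ` (HB {Vx} - t)"

text \<open>Completing the positive literals of \<open>c\<close> by the negations of all other atoms
  gives a consistent set that contains \<open>c\<close>; by maximality it is \<open>c\<close>
  itself. So a cell is determined by its positive atoms.\<close>

lemma is_cellD:
  assumes "is_cell Ps ar c"
  shows "cell_of {l. Atm l \<in> c} = c"
    and "{l. Atm l \<in> c} \<subseteq> HB {Vx}"
proof -
  let ?t = "{l. Atm l \<in> c}"
  let ?c = "cell_of ?t"
  have c: "c \<subseteq> cell_literals Ps ar" "consistent c"
    and max: "\<And>c'. c \<subset> c' \<Longrightarrow> c' \<subseteq> cell_literals Ps ar \<Longrightarrow> \<not> consistent c'"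
    using assms by (auto simp: is_cell_def)
  show t: "?t \<subseteq> HB {Vx}"
    using c(1) by (auto simp: cell_literals_def)
  have "c \<subseteq> ?c"
    using c by (force simp: cell_literals_def consistent_def cell_of_def)
  moreover have "?c \<subseteq> cell_literals Ps ar" "consistent ?c"
    using t by (auto simp: cell_literals_def consistent_def cell_of_def)
  ultimately show "?c = c"
    using max by blast
qed

text \<open>Maximal because each atom already occurs with one sign, so any further literal
  contradicts one that is present.\<close>

lemma is_cell_of_atoms:
  assumes "t \<subseteq> HB {Vx}"
  shows "is_cell Ps ar (cell_of t)"
  unfolding is_cell_def
proof (intro conjI allI impI; (elim conjE)?)
  fix c' assume c': "cell_of t \<subset> c'" "c' \<subseteq> cell_literals Ps ar"
  then obtain F where F: "F \<in> c'" "F \<notin> cell_of t" and sub: "cell_of t \<subseteq> c'"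
    by blast
  with c' consider l where "F = Atm l" "l \<in> HB {Vx}" | l where "F = Neg (Atm l)" "l \<in> HB {Vx}"
    by (auto simp: cell_literals_def)
  then show "\<not> consistent c'"
  proof cases
    case (1 l)
    with F have "Neg (Atm l) \<in> cell_of t" by (auto simp: cell_of_def)
    with sub have "Neg (Atm l) \<in> c'" ..
    with 1 F show ?thesis by (auto simp: consistent_def)
  next
    case (2 l)
    with F have "Atm l \<in> cell_of t" by (auto simp: cell_of_def)
    with sub have "Atm l \<in> c'" ..
    with 2 F show ?thesis by (auto simp: consistent_def)
  qed
qed (use assms in \<open>auto simp: cell_literals_def consistent_def cell_of_def\<close>)

lemma block_single_image: "block {a} = map_atom id (\<lambda>_. a) ` HB {Vx}"
  using atoms_over_image[of Ps ar "\<lambda>_. a" "{Vx}"] by (simp flip: HB_single)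

lemma inj_on_single: "inj_on (map_atom id (\<lambda>_. a)) (HB {Vx})"
  by (rule inj_on_map_atom) simp

lemma cell_world_subset:
  assumes "is_cell Ps ar c"
  shows "cell_world c a \<subseteq> block {a}"
  unfolding cell_world_def block_single_image
  using is_cellD(2)[OF assms] by (rule image_mono)

lemma cell_world_eq_iff:
  assumes "is_cell Ps ar c" "is_cell Ps ar d"
  shows "cell_world c a = cell_world d a \<longleftrightarrow> c = d"
proof
  assume "cell_world c a = cell_world d a"
  then have "{l. Atm l \<in> c} = {l. Atm l \<in> d}"
    unfolding cell_world_def
    by (rule inj_on_image_eq_iff[THEN iffD1, OF inj_on_single[of a] assms[THEN is_cellD(2)]])
  then have "cell_of {l. Atm l \<in> c} = cell_of {l. Atm l \<in> d}"
    by (rule arg_cong)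
  then show "c = d"
    by (simp only: assms[THEN is_cellD(1)])
qed simp

text \<open>A cell decides every atom of the constant, hence conditioning on it fixes the whole
  block of \<open>{a}\<close>.\<close>

lemma sat_cell_at:
  assumes "is_cell Ps ar c"
  shows "(\<forall>F\<in>cell_at c a. sat \<omega> F) \<longleftrightarrow> \<omega> \<inter> block {a} = cell_world c a"
proof -
  let ?f = "map_atom id (\<lambda>_. a) :: ('p, var) atom \<Rightarrow> ('p, _) atom" and ?t = "{l. Atm l \<in> c}"
  have t: "?t \<subseteq> HB {Vx}"
    by (rule is_cellD(2)[OF assms])
  have mem: "?f l \<in> ?f ` ?t \<longleftrightarrow> l \<in> ?t" if "l \<in> HB {Vx}" for l
    by (rule inj_on_image_mem_iff[OF inj_on_single that t])
  have "(\<forall>F\<in>cell_at c a. sat \<omega> F) \<longleftrightarrow> (\<forall>F\<in>c. sat (?f -` \<omega>) F)"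
    by (simp add: cell_at_def sat_inst)
  also have "\<dots> \<longleftrightarrow> (\<forall>F\<in>cell_of ?t. sat (?f -` \<omega>) F)"
    by (simp only: is_cellD(1)[OF assms])
  also have "\<dots> \<longleftrightarrow> (\<forall>l\<in>?t. ?f l \<in> \<omega>) \<and> (\<forall>l\<in>HB {Vx} - ?t. ?f l \<notin> \<omega>)"
    by (simp only: cell_of_def ball_Un ball_simps o_apply sat.simps vimage_eq)
  also have "\<dots> \<longleftrightarrow> (\<forall>l\<in>HB {Vx}. ?f l \<in> \<omega> \<longleftrightarrow> l \<in> ?t)"
    using t by blast
  also have "\<dots> \<longleftrightarrow> (\<forall>l\<in>HB {Vx}. ?f l \<in> \<omega> \<longleftrightarrow> ?f l \<in> ?f ` ?t)"
    using mem by blast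
  also have "\<dots> \<longleftrightarrow> (\<forall>l\<in>block {a}. l \<in> \<omega> \<longleftrightarrow> l \<in> cell_world c a)"
    unfolding block_single_image cell_world_def ball_simps ..
  also have "\<dots> \<longleftrightarrow> \<omega> \<inter> block {a} = cell_world c a"
    using cell_world_subset[OF assms, of a] by blast
  finally show ?thesis .
qed

text \<open>Identifies the atoms that \<open>pair_weight\<close> reweights to 1: exactly the blocks
  of the two single constants.\<close>

lemma set_fm_cell_at:
  assumes "is_cell Ps ar c"
  shows "\<Union> (set_fm ` cell_at c a) = block {a}"
proof -
  have "\<Union> (set_fm ` cell_of {l. Atm l \<in> c}) = HB {Vx}"
    using is_cellD(2)[OF assms] by (auto simp: cell_of_def)
  then have "\<Union> (set_fm ` c) = HB {Vx}"
    by (simp only: is_cellD(1)[OF assms])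
  moreover have "\<Union> (set_fm ` cell_at c a) = map_atom id (\<lambda>_. a) ` \<Union> (set_fm ` c)"
    by (simp add: cell_at_def set_fm_inst image_UN image_comp)
  ultimately show ?thesis
    by (simp only: block_single_image)
qed

lemma sat_inst2_cong:
  "\<omega> \<inter> HB {a, b} = \<omega>' \<inter> HB {a, b} \<Longrightarrow> sat \<omega> (inst2 \<psi> a b) \<longleftrightarrow> sat \<omega>' (inst2 \<psi> a b)"
  by (rule sat_cong) (use set_fm_inst2[of a b] in blast)

definition good_cell_world :: "'c \<Rightarrow> ('p, 'c) atom set \<Rightarrow> bool" where
  "good_cell_world a \<omega> \<longleftrightarrow> sat \<omega> (inst2 \<psi> a a) \<and> Atom le [a, a] \<in> \<omega>"

text \<open>Not symmetric: the first argument is the earlier element of the order.\<close>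

definition good_pair_world :: "'c \<Rightarrow> 'c \<Rightarrow> ('p, 'c) atom set \<Rightarrow> bool" where
  "good_pair_world a b \<omega> \<longleftrightarrow> sat \<omega> (inst2 \<psi> a b) \<and> sat \<omega> (inst2 \<psi> b a) \<and>
     Atom le [a, b] \<in> \<omega> \<and> Atom le [b, a] \<notin> \<omega>"

lemma le_atom_in_HB: "a \<in> D \<Longrightarrow> b \<in> D \<Longrightarrow> Atom le [a, b] \<in> HB D"
  using le_in ar_le by (simp add: atoms_over_iff)

lemma good_cell_world_cong:
  assumes "\<omega> \<inter> block {a} = \<omega>' \<inter> block {a}"
  shows "good_cell_world a \<omega> \<longleftrightarrow> good_cell_world a \<omega>'"
  using assms sat_inst2_cong[of \<omega> a a \<omega>'] le_atom_in_HB[of a "{a}" a]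
  by (auto simp: good_cell_world_def HB_single)

lemma good_pair_world_cong:
  assumes "\<omega> \<inter> HB {a, b} = \<omega>' \<inter> HB {a, b}"
  shows "good_pair_world a b \<omega> \<longleftrightarrow> good_pair_world a b \<omega>'"
  using assms sat_inst2_cong[of \<omega> a b \<omega>'] sat_inst2_cong[of \<omega> b a \<omega>']
    le_atom_in_HB[of a "{a, b}" b] le_atom_in_HB[of b "{a, b}" a]
  by (auto simp: good_pair_world_def insert_commute)

text \<open>Validity is tested at the variable \<open>Vx\<close>. Renaming \<open>Vx\<close> to
  \<open>a\<close> is injective on the atoms over \<open>Vx\<close>, so the test has the same
  outcome at every constant.\<close>

lemma good_cell_world_iff_valid:
  assumes "is_cell Ps ar c"
  shows "good_cell_world a (cell_world c a) \<longleftrightarrow> is_valid c"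
proof -
  let ?f = "map_atom id (\<lambda>_. a) :: ('p, var) atom \<Rightarrow> ('p, _) atom" and ?t = "{l. Atm l \<in> c}"
  have mem: "?f l \<in> ?f ` ?t \<longleftrightarrow> l \<in> ?t" if "l \<in> HB {Vx}" for l
    by (rule inj_on_image_mem_iff[OF inj_on_single that is_cellD(2)[OF assms]])
  have "inst2 \<psi> a a = map_fm ?f (inst2 \<psi> Vx Vx)"
    by (simp add: map_fm_inst2)
  then have "sat (cell_world c a) (inst2 \<psi> a a) \<longleftrightarrow> sat (?f -` ?f ` ?t) (inst2 \<psi> Vx Vx)"
    by (simp add: sat_map_fm cell_world_def)
  also have "\<dots> \<longleftrightarrow> sat ?t (inst2 \<psi> Vx Vx)"
    by (rule sat_inst2_cong) (use mem in auto)
  finally show ?thesis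
    using assms mem[OF le_atom_in_HB[of Vx "{Vx}" Vx]]
    by (simp add: good_cell_world_def valid_cell_def cell_world_def)
qed

section \<open>The values of cell weights and pair weights\<close>

lemma cell_weight_eq:
  assumes "is_valid c"
  shows "cell_weight Ps ar \<psi> w wb a c = weight (block {a}) (cell_world c a)"
proof -
  have c: "is_cell Ps ar c"
    using assms by (simp add: valid_cell_def)
  have "sat (cell_world c a) (inst2 \<psi> a a)"
    using good_cell_world_iff_valid[OF c, of a] assms by (simp add: good_cell_world_def)
  moreover have "cell_world c a \<subseteq> block {a}"
    by (rule cell_world_subset[OF c])
  \<comment> \<open>All atoms over \<open>{a}\<close> are fixed by the cell, so the count has a
    single model.\<close>
  ultimately have "{\<omega>. \<omega> \<subseteq> HB {a} \<and> (\<forall>F\<in>psi1 \<psi> c a. sat \<omega> F)} = {cell_world c a}"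
    using sat_cell_at[OF c, of a] by (auto simp: psi1_def HB_single inf.absorb1)
  then show ?thesis
    by (simp add: cell_weight_def wmc_eq_world_weight) (simp add: HB_single)
qed

lemma weight_cell_world:
  assumes "is_cell Ps ar c"
  shows "weight (block {a}) (cell_world c a) = weight (HB {Vx}) {l. Atm l \<in> c}"
  unfolding block_single_image world_weight_def
  by (subst prod.reindex[OF inj_on_single])
    (auto simp: cell_world_def atom.map_sel
      inj_on_image_mem_iff[OF inj_on_single _ is_cellD(2)[OF assms]] intro!: prod.cong)

lemma cell_weight_indep:
  assumes "is_valid c"
  shows "cell_weight Ps ar \<psi> w wb A c = cell_weight Ps ar \<psi> w wb a c"
  using assms cell_weight_eq[OF assms, of A] cell_weight_eq[OF assms, of a]
  by (simp add: weight_cell_world valid_cell_def)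

text \<open>The blocks of \<open>a\<close> and \<open>b\<close> contribute the factor 1, and only
  the atoms that mention both constants are weighed.\<close>

lemma pair_world_weight:
  assumes "a \<noteq> b"
  shows "world_weight (HB {a, b}) (unweight (block {a} \<union> block {b}) (w \<circ> pred))
      (unweight (block {a} \<union> block {b}) (wb \<circ> pred)) \<omega> = weight (block {a, b}) \<omega>"
proof -
  let ?S = "block {a} \<union> block {b}"
  have disj: "?S \<inter> block {a, b} = {}"
    using assms by (auto simp: atom_block_def)
  have "world_weight ?S (unweight ?S (w \<circ> pred)) (unweight ?S (wb \<circ> pred)) \<omega> = 1"
    unfolding world_weight_def by (rule prod.neutral) (auto simp: unweight_def)
  moreover have "world_weight (block {a, b}) (unweight ?S (w \<circ> pred)) (unweight ?S (wb \<circ> pred)) \<omega>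
      = weight (block {a, b}) \<omega>"
    using disj by (intro world_weight_cong) (auto simp: unweight_def)
  ultimately show ?thesis
    unfolding HB_pair using disj by (subst world_weight_Un) simp_all
qed

text \<open>The cells leave only the block of \<open>{a, b}\<close> free. The arguments of
  \<open>good_pair_world\<close> are swapped because the added literals state that the second
  constant precedes the first.\<close>

lemma pair_weight_eq:
  assumes "a \<noteq> b" "is_cell Ps ar c" "is_cell Ps ar d"
  shows "pair_weight Ps ar le \<psi> w wb a b c d
    = (\<Sum>x\<in>Pow (block {a, b}).
        of_bool (good_pair_world b a (cell_world c a \<union> cell_world d b \<union> x)) * weight (block {a, b}) x)"
proof -
  let ?u = "cell_world c a \<union> cell_world d b"
  let ?\<Gamma> = "psi2 \<psi> c d a b \<union> {Atm (Atom le [b, a]), Neg (Atm (Atom le [a, b]))}"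
  have disj: "block {a} \<inter> block {a, b} = {}" "block {b} \<inter> block {a, b} = {}"
      "block {a} \<inter> block {b} = {}"
    using assms(1) by (auto simp: atom_block_def)
  have sub: "cell_world c a \<subseteq> block {a}" "cell_world d b \<subseteq> block {b}"
    using assms by (simp_all add: cell_world_subset)
  have sat: "(\<forall>F\<in>?\<Gamma>. sat \<omega> F) \<longleftrightarrow> good_pair_world b a \<omega> \<and>
      \<omega> \<inter> block {a} = cell_world c a \<and> \<omega> \<inter> block {b} = cell_world d b" for \<omega>
    using sat_cell_at[OF assms(2), of a \<omega>] sat_cell_at[OF assms(3), of b \<omega>]
    by (auto simp: psi2_def good_pair_world_def)
  have split: "\<omega> = ?u \<union> (\<omega> \<inter> block {a, b})"
    if "\<omega> \<subseteq> HB {a, b}" "\<omega> \<inter> block {a} = cell_world c a" "\<omega> \<inter> block {b} = cell_world d b" for \<omega>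
    using that unfolding HB_pair by blast
  have S: "\<Union> (set_fm ` (cell_at c a \<union> cell_at d b)) = block {a} \<union> block {b}"
    using assms by (simp only: image_Un Union_Un_distrib set_fm_cell_at)
  have "pair_weight Ps ar le \<psi> w wb a b c d
      = (\<Sum>\<omega> | \<omega> \<subseteq> HB {a, b} \<and> (\<forall>F\<in>?\<Gamma>. sat \<omega> F). weight (block {a, b}) \<omega>)"
    unfolding pair_weight_def Let_def S
    by (simp only: wmc_eq_world_weight[OF finite_HB] pair_world_weight[OF assms(1)]
        finite.insertI finite.emptyI)
  also have "\<dots> = (\<Sum>x | x \<in> Pow (block {a, b}) \<and> good_pair_world b a (?u \<union> x).
      weight (block {a, b}) x)"
  proof (rule sum.reindex_bij_witness[of _ "\<lambda>x. ?u \<union> x" "\<lambda>\<omega>. \<omega> \<inter> block {a, b}"])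
    fix \<omega> assume "\<omega> \<in> {\<omega>. \<omega> \<subseteq> HB {a, b} \<and> (\<forall>F\<in>?\<Gamma>. sat \<omega> F)}"
    then have \<omega>: "\<omega> \<subseteq> HB {a, b}" "good_pair_world b a \<omega>"
        "\<omega> \<inter> block {a} = cell_world c a" "\<omega> \<inter> block {b} = cell_world d b"
      unfolding sat by auto
    show "?u \<union> (\<omega> \<inter> block {a, b}) = \<omega>"
      by (rule split[symmetric]) (fact \<omega>)+
    then show "\<omega> \<inter> block {a, b} \<in> {x \<in> Pow (block {a, b}). good_pair_world b a (?u \<union> x)}"
      using \<omega>(2) by simp
    show "weight (block {a, b}) (\<omega> \<inter> block {a, b}) = weight (block {a, b}) \<omega>"
      by (rule world_weight_cong) auto
  next
    fix x assume x: "x \<in> {x \<in> Pow (block {a, b}). good_pair_world b a (?u \<union> x)}"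
    then show "?u \<union> x \<in> {\<omega>. \<omega> \<subseteq> HB {a, b} \<and> (\<forall>F\<in>?\<Gamma>. sat \<omega> F)}"
      unfolding sat HB_pair using sub disj by blast
    show "(?u \<union> x) \<inter> block {a, b} = x"
      using x sub disj by blast
  qed
  also have "\<dots> = (\<Sum>x\<in>Pow (block {a, b}).
      of_bool (good_pair_world b a (?u \<union> x)) * weight (block {a, b}) x)"
    by (rule sum_filter_eq_sum_of_bool) simp
  finally show ?thesis .
qed

lemma pair_weight_indep:
  assumes "A \<noteq> B" "a \<noteq> b" "is_cell Ps ar c" "is_cell Ps ar d"
  shows "pair_weight Ps ar le \<psi> w wb A B c d = pair_weight Ps ar le \<psi> w wb a b c d"
proof -
  \<comment> \<open>All constants other than \<open>A\<close> are sent to \<open>b\<close>;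
    injectivity on \<open>{A, B}\<close> suffices, and it comes from
    \<open>a \<noteq> b\<close>.\<close>
  define \<sigma> where "\<sigma> = (\<lambda>z. if z = A then a else b)"
  have \<sigma>: "\<sigma> A = a" "\<sigma> B = b" "inj_on \<sigma> {A, B}"
    using assms by (auto simp: \<sigma>_def inj_on_def)
  let ?f = "map_atom id \<sigma> :: ('p, _) atom \<Rightarrow> ('p, _) atom"
  let ?\<Gamma> = "psi2 \<psi> c d A B \<union> {Atm (Atom le [B, A]), Neg (Atm (Atom le [A, B]))}"
  let ?S = "block {A} \<union> block {B}" and ?S' = "block {a} \<union> block {b}"
  have S: "\<Union> (set_fm ` (cell_at c A \<union> cell_at d B)) = ?S"
    and S': "\<Union> (set_fm ` (cell_at c a \<union> cell_at d b)) = ?S'"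
    using assms by (simp_all only: image_Un Union_Un_distrib set_fm_cell_at)
  have inj: "inj_on ?f (HB {A, B})"
    using \<sigma>(3) by (rule inj_on_map_atom)
  have image: "HB {a, b} = ?f ` HB {A, B}"
    using atoms_over_image[of Ps ar \<sigma> "{A, B}"] \<sigma> by simp
  have image_S: "?S' = ?f ` ?S"
    using atoms_over_image[of Ps ar \<sigma> "{A}"] atoms_over_image[of Ps ar \<sigma> "{B}"] \<sigma>
    by (simp add: HB_single image_Un)
  have sub_S: "?S \<subseteq> HB {A, B}"
    unfolding HB_pair by blast
  have image_cell: "map_fm ?f ` cell_at e x = cell_at e (\<sigma> x)" for e x
    by (simp add: cell_at_def image_image map_fm_inst comp_def)
  have \<Gamma>: "psi2 \<psi> c d a b \<union> {Atm (Atom le [b, a]), Neg (Atm (Atom le [a, b]))} = map_fm ?f ` ?\<Gamma>"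
    by (simp add: psi2_def image_Un image_cell map_fm_inst2 \<sigma>)
  have atoms: "set_fm F \<subseteq> HB {A, B}" if F: "F \<in> ?\<Gamma>" for F
  proof -
    consider "F = inst2 \<psi> A B" | "F = inst2 \<psi> B A" | "F \<in> cell_at c A \<union> cell_at d B"
      | "F = Atm (Atom le [B, A])" | "F = Neg (Atm (Atom le [A, B]))"
      using F by (auto simp: psi2_def)
    then show ?thesis
    proof cases
      case 1
      then show ?thesis by (simp only: set_fm_inst2)
    next
      case 2
      then show ?thesis using set_fm_inst2[of B A] by (simp only: insert_commute)
    next
      case 3
      from UN_upper[OF this, of set_fm] show ?thesis
        unfolding S using sub_S by (rule order_trans)
    qed (simp_all add: le_atom_in_HB)
  qed
  have weights: "(unweight ?S' (v \<circ> pred) \<circ> ?f) l = unweight ?S (v \<circ> pred) l"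
    if "l \<in> HB {A, B}" for v :: "'p \<Rightarrow> real" and l
    using inj_on_image_mem_iff[OF inj that sub_S]
    by (simp add: unweight_def image_S atom.map_sel)
  have "pair_weight Ps ar le \<psi> w wb a b c d
      = wmc (HB {A, B}) ?\<Gamma> (unweight ?S' (w \<circ> pred) \<circ> ?f) (unweight ?S' (wb \<circ> pred) \<circ> ?f)"
    unfolding pair_weight_def Let_def S' \<Gamma> image
    by (rule wmc_image) (use inj atoms in simp_all)
  also have "\<dots> = wmc (HB {A, B}) ?\<Gamma> (unweight ?S (w \<circ> pred)) (unweight ?S (wb \<circ> pred))"
    by (rule wmc_cong_weights) (use weights in simp_all)
  also have "\<dots> = pair_weight Ps ar le \<psi> w wb A B c d"
    unfolding pair_weight_def Let_def S ..
  finally show ?thesis ..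
qed

section \<open>From models of the ordered sentence to independent blocks\<close>

lemma ordered_model_iff:
  assumes "\<omega> \<subseteq> HB {1..n}"
  shows "models_forall2 {1..n} \<omega> \<psi> \<and>
      proj \<omega> le = {Atom le [a, b] | a b. 1 \<le> a \<and> a \<le> b \<and> b \<le> n}
    \<longleftrightarrow> (\<forall>a\<in>{1..n}. good_cell_world a \<omega>) \<and> (\<forall>(a, b)\<in>ordered_pairs n. good_pair_world a b \<omega>)"
proof -
  \<comment> \<open>Since the order predicate is binary, its atoms in the world are all of the form
    \<open>Atom le [a, b]\<close> over the domain, so the equation for \<open>proj\<close> can be
    tested pair by pair.\<close>
  have "proj \<omega> le \<subseteq> {Atom le [a, b] | a b. a \<in> {1..n} \<and> b \<in> {1..n}}"
  proof
    fix l assume "l \<in> proj \<omega> le"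
    then have "l \<in> HB {1..n}" "pred l = le"
      using assms by (auto simp: proj_def)
    then show "l \<in> {Atom le [a, b] | a b. a \<in> {1..n} \<and> b \<in> {1..n}}"
      using ar_le by (cases l) (auto simp: atoms_over_iff length_Suc_conv numeral_2_eq_2)
  qed
  then have sub: "l \<in> {Atom le [a, b] | a b. a \<in> {1..n} \<and> b \<in> {1..n}}" if "l \<in> proj \<omega> le" for l
    using that ..
  have proj: "proj \<omega> le = {Atom le [a, b] | a b. 1 \<le> a \<and> a \<le> b \<and> b \<le> n}
      \<longleftrightarrow> (\<forall>a\<in>{1..n}. \<forall>b\<in>{1..n}. Atom le [a, b] \<in> \<omega> \<longleftrightarrow> a \<le> b)" (is "_ = ?L \<longleftrightarrow> ?R")
  proof
    assume eq: "proj \<omega> le = ?L"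
    show ?R
    proof (intro ballI)
      fix a b assume "a \<in> {1..n}" "b \<in> {1..n}"
      then have "Atom le [a, b] \<in> ?L \<longleftrightarrow> a \<le> b"
        by simp
      then show "Atom le [a, b] \<in> \<omega> \<longleftrightarrow> a \<le> b"
        unfolding eq[symmetric] by (simp add: proj_def)
    qed
  next
    assume R: ?R
    show "proj \<omega> le = ?L"
    proof (intro subset_antisym subsetI)
      fix l assume l: "l \<in> proj \<omega> le"
      from sub[OF this] obtain a b where ab: "l = Atom le [a, b]" "a \<in> {1..n}" "b \<in> {1..n}"
        by blast
      moreover have "a \<le> b"
        using R l ab by (simp add: proj_def)
      ultimately show "l \<in> ?L"
        by simp
    next
      fix l assume "l \<in> ?L"
      then obtain a b where "l = Atom le [a, b]" "1 \<le> a" "a \<le> b" "b \<le> n"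
        by blast
      then show "l \<in> proj \<omega> le"
        using R by (simp add: proj_def)
    qed
  qed
  show ?thesis
  proof
    assume "models_forall2 {1..n} \<omega> \<psi> \<and>
      proj \<omega> le = {Atom le [a, b] | a b. 1 \<le> a \<and> a \<le> b \<and> b \<le> n}"
    then show "(\<forall>a\<in>{1..n}. good_cell_world a \<omega>) \<and> (\<forall>(a, b)\<in>ordered_pairs n. good_pair_world a b \<omega>)"
      unfolding proj
      by (auto simp: models_forall2_def good_cell_world_def good_pair_world_def ordered_pairs_def)
  next
    assume good: "(\<forall>a\<in>{1..n}. good_cell_world a \<omega>) \<and> (\<forall>(a, b)\<in>ordered_pairs n. good_pair_world a b \<omega>)"
    \<comment> \<open>Each \<open>good_pair_world\<close> covers both instances of the sentence and
      both order atoms, so the case \<open>a > b\<close> is read off from the pair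
      \<open>(b, a)\<close>.\<close>
    have "sat \<omega> (inst2 \<psi> a b) \<and> (Atom le [a, b] \<in> \<omega> \<longleftrightarrow> a \<le> b)" if "a \<in> {1..n}" "b \<in> {1..n}" for a b
    proof (cases a b rule: linorder_cases)
      case less
      with that have "(a, b) \<in> ordered_pairs n" by (simp add: ordered_pairs_def)
      with good less show ?thesis by (auto simp: good_pair_world_def)
    next
      case equal
      with good that show ?thesis by (auto simp: good_cell_world_def)
    next
      case greater
      with that have "(b, a) \<in> ordered_pairs n" by (simp add: ordered_pairs_def)
      with good greater show ?thesis by (auto simp: good_pair_world_def)
    qed
    then show "models_forall2 {1..n} \<omega> \<psi> \<and>
        proj \<omega> le = {Atom le [a, b] | a b. 1 \<le> a \<and> a \<le> b \<and> b \<le> n}"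
      unfolding proj by (auto simp: models_forall2_def)
  qed
qed

lemma pair_blocks_disjoint:
  assumes "i \<in> ordered_pairs n" "j \<in> ordered_pairs n" "i \<noteq> j"
  shows "(case i of (a, b) \<Rightarrow> block {a, b}) \<inter> (case j of (a, b) \<Rightarrow> block {a, b}) = {}"
proof -
  obtain a b c d where ij: "i = (a, b)" "j = (c, d)"
    by fastforce
  with assms have "{a, b} \<noteq> {c, d}"
    by (auto simp: ordered_pairs_def doubleton_eq_iff)
  then show ?thesis
    unfolding ij prod.case by (rule atom_block_disjoint)
qed

lemma cell_pair_blocks_disjoint:
  "(\<Union>a\<in>{1..n}. block {a}) \<inter> (\<Union>(a, b)\<in>ordered_pairs n. block {a, b}) = {}"
proof -
  have "block {a} \<inter> block {b, c} = {}" if "(b, c) \<in> ordered_pairs n" for a b c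
    by (rule atom_block_disjoint) (use that in \<open>auto simp: ordered_pairs_def\<close>)
  then show ?thesis by fast
qed

lemma weight_HB_interval:
  "weight (HB {1..n}) \<omega> = (\<Prod>a\<in>{1..n}. weight (block {a}) \<omega>)
     * (\<Prod>(a, b)\<in>ordered_pairs n. weight (block {a, b}) \<omega>)"
proof -
  have "weight (HB {1..n}) \<omega> = weight (\<Union>a\<in>{1..n}. block {a}) \<omega>
      * weight (\<Union>(a, b)\<in>ordered_pairs n. block {a, b}) \<omega>"
    unfolding HB_interval by (rule world_weight_Un[OF _ _ cell_pair_blocks_disjoint]) auto
  moreover have "weight (\<Union>a\<in>{1..n}. block {a}) \<omega> = (\<Prod>a\<in>{1..n}. weight (block {a}) \<omega>)"
    by (rule world_weight_UN) (auto simp: atom_block_disjoint)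
  moreover have "weight (\<Union>i\<in>ordered_pairs n. case i of (a, b) \<Rightarrow> block {a, b}) \<omega>
      = (\<Prod>i\<in>ordered_pairs n. weight (case i of (a, b) \<Rightarrow> block {a, b}) \<omega>)"
  proof (rule world_weight_UN)
    fix i j assume "i \<in> ordered_pairs n" "j \<in> ordered_pairs n" "i \<noteq> j"
    then show "(case i of (a, b) \<Rightarrow> block {a, b}) \<inter> (case j of (a, b) \<Rightarrow> block {a, b}) = {}"
      by (rule pair_blocks_disjoint)
  qed auto
  ultimately show ?thesis
    by (simp add: case_prod_beta)
qed

text \<open>\<open>u\<close> is the part of the world on single-constant atoms. Once it is fixed, no
  constraint links two different pair blocks, so their sums separate. The sum over \<open>u\<close>
  stays outside, since a pair factor couples two constants.\<close>

lemma wfomc_ordered_factor: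
  "wfomc_ordered Ps ar le \<psi> w wb n = (\<Sum>u\<in>Pow (\<Union>a\<in>{1..n}. block {a}).
      (\<Prod>a\<in>{1..n}. of_bool (good_cell_world a u) * weight (block {a}) u) *
      (\<Prod>(a, b)\<in>ordered_pairs n. \<Sum>x\<in>Pow (block {a, b}).
         of_bool (good_pair_world a b (u \<union> x)) * weight (block {a, b}) x))"
proof -
  let ?U = "\<Union>a\<in>{1..n}. block {a}" and ?X = "\<Union>(a, b)\<in>ordered_pairs n. block {a, b}"
  let ?g = "\<lambda>a \<omega>. of_bool (good_cell_world a \<omega>) * weight (block {a}) \<omega>"
  let ?h = "\<lambda>u (a, b) x. of_bool (good_pair_world a b (u \<union> x)) * weight (block {a, b}) x"
  let ?B = "\<lambda>(a, b). block {a, b}"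
  have "wfomc_ordered Ps ar le \<psi> w wb n
      = (\<Sum>\<omega> | \<omega> \<in> Pow (HB {1..n}) \<and> (\<forall>a\<in>{1..n}. good_cell_world a \<omega>) \<and>
          (\<forall>(a, b)\<in>ordered_pairs n. good_pair_world a b \<omega>). weight (HB {1..n}) \<omega>)"
    unfolding wfomc_ordered_def Let_def
  proof (rule sum.cong)
    show "{\<omega>. \<omega> \<subseteq> HB {1..n} \<and> models_forall2 {1..n} \<omega> \<psi> \<and>
            proj \<omega> le = {Atom le [a, b] | a b. 1 \<le> a \<and> a \<le> b \<and> b \<le> n}}
        = {\<omega> \<in> Pow (HB {1..n}). (\<forall>a\<in>{1..n}. good_cell_world a \<omega>) \<and>
            (\<forall>(a, b)\<in>ordered_pairs n. good_pair_world a b \<omega>)}"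
      by (rule Collect_cong, rule conj_cong, simp, rule ordered_model_iff) simp
  qed (auto simp: world_weight_eq[symmetric])
  also have "\<dots> = (\<Sum>\<omega>\<in>Pow (HB {1..n}). of_bool ((\<forall>a\<in>{1..n}. good_cell_world a \<omega>) \<and>
          (\<forall>(a, b)\<in>ordered_pairs n. good_pair_world a b \<omega>)) * weight (HB {1..n}) \<omega>)"
    by (rule sum_filter_eq_sum_of_bool) simp
  also have "\<dots> = (\<Sum>\<omega>\<in>Pow (?U \<union> ?X). (\<Prod>a\<in>{1..n}. ?g a \<omega>) *
      (\<Prod>(a, b)\<in>ordered_pairs n. of_bool (good_pair_world a b \<omega>) * weight (block {a, b}) \<omega>))"
    unfolding HB_interval[symmetric] weight_HB_interval
    by (intro sum.cong refl) (simp add: prod_of_bool_mult case_prod_beta of_bool_conj)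
  also have "\<dots> = (\<Sum>u\<in>Pow ?U. \<Sum>x\<in>Pow ?X. (\<Prod>a\<in>{1..n}. ?g a (u \<union> x)) *
      (\<Prod>(a, b)\<in>ordered_pairs n.
        of_bool (good_pair_world a b (u \<union> x)) * weight (block {a, b}) (u \<union> x)))"
    by (rule sum_Pow_Un[OF cell_pair_blocks_disjoint])
  \<comment> \<open>Each factor is restricted to the atoms it can see: the cell factors ignore
    \<open>x\<close>, and a pair factor sees only the trace of \<open>x\<close> on its own block.
    This is the form that \<open>sum_Pow_UN\<close> requires.\<close>
  also have "\<dots> = (\<Sum>u\<in>Pow ?U. \<Sum>x\<in>Pow ?X. (\<Prod>a\<in>{1..n}. ?g a u) *
      (\<Prod>i\<in>ordered_pairs n. ?h u i (x \<inter> ?B i)))"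
  proof (intro sum.cong refl, rule arg_cong2[where f = "(*)"]; rule prod.cong[OF refl])
    fix u x a assume x: "x \<in> Pow ?X" and a: "a \<in> {1..n}"
    have eq: "(u \<union> x) \<inter> block {a} = u \<inter> block {a}"
      using x a cell_pair_blocks_disjoint[of n] by blast
    show "?g a (u \<union> x) = ?g a u"
      using good_cell_world_cong[OF eq] world_weight_cong[OF eq refl refl] by (simp only:)
  next
    fix u x i assume u: "u \<in> Pow ?U" and x: "x \<in> Pow ?X" and i: "i \<in> ordered_pairs n"
    obtain a b where ab: "i = (a, b)"
      by fastforce
    have ab_n: "a \<in> {1..n}" "b \<in> {1..n}"
      using i ab by (auto simp: ordered_pairs_def)
    have "block {a} \<subseteq> ?U" "block {b} \<subseteq> ?U" "block {a, b} \<subseteq> ?X"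
      using ab_n i ab by blast+
    then have eq: "(u \<union> x) \<inter> HB {a, b} = (u \<union> (x \<inter> block {a, b})) \<inter> HB {a, b}"
      and eq': "(u \<union> x) \<inter> block {a, b} = (x \<inter> block {a, b}) \<inter> block {a, b}"
      unfolding HB_pair using u x cell_pair_blocks_disjoint[of n] by blast+
    show "(case i of (a, b) \<Rightarrow>
        of_bool (good_pair_world a b (u \<union> x)) * weight (block {a, b}) (u \<union> x))
      = ?h u i (x \<inter> ?B i)"
      using good_pair_world_cong[OF eq] world_weight_cong[OF eq' refl refl] by (simp only: ab prod.case)
  qed
  also have "\<dots> = (\<Sum>u\<in>Pow ?U. (\<Prod>a\<in>{1..n}. ?g a u) * (\<Sum>x\<in>Pow ?X. \<Prod>i\<in>ordered_pairs n. ?h u i (x \<inter> ?B i)))"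
    by (simp only: sum_distrib_left)
  also have "\<dots> = (\<Sum>u\<in>Pow ?U. (\<Prod>a\<in>{1..n}. ?g a u) * (\<Prod>i\<in>ordered_pairs n. \<Sum>x\<in>Pow (?B i). ?h u i x))"
    by (subst sum_Pow_UN[OF finite_ordered_pairs pair_blocks_disjoint]) simp_all
  finally show ?thesis
    by (simp add: case_prod_beta)
qed

section \<open>The sum over assignments of valid cells\<close>

context
  fixes C :: "('p, var) atom fm set list"
  assumes distinct_C: "distinct C" and set_C: "set C = {c. is_valid c}"
begin

definition assignment_world :: "nat \<Rightarrow> (nat \<Rightarrow> nat) \<Rightarrow> ('p, nat) atom set" where
  "assignment_world n f = (\<Union>a\<in>{1..n}. cell_world (C ! f a) a)"

lemma valid_nth: "i < length C \<Longrightarrow> is_valid (C ! i)"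
  using set_C nth_mem by blast

lemma is_cell_nth: "i < length C \<Longrightarrow> is_cell Ps ar (C ! i)"
  using valid_nth by (simp add: valid_cell_def)

lemma assignment_world_block:
  assumes "f \<in> {1..n} \<rightarrow>\<^sub>E {..<length C}" "a \<in> {1..n}"
  shows "assignment_world n f \<inter> block {a} = cell_world (C ! f a) a"
proof -
  have sub: "cell_world (C ! f b) b \<subseteq> block {b}" if "b \<in> {1..n}" for b
    using assms(1) that by (intro cell_world_subset is_cell_nth) auto
  have "cell_world (C ! f b) b \<inter> block {a} = {}" if "b \<in> {1..n}" "b \<noteq> a" for b
    using sub[OF that(1)] atom_block_disjoint[of "{b}" "{a}" Ps ar] that by auto
  then show ?thesis
    using assms(2) sub[OF assms(2)] unfolding assignment_world_def by blast
qed

lemma assignment_world_subset: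
  assumes "f \<in> {1..n} \<rightarrow>\<^sub>E {..<length C}"
  shows "assignment_world n f \<subseteq> (\<Union>a\<in>{1..n}. block {a})"
  unfolding assignment_world_def
  using assms by (intro UN_mono cell_world_subset is_cell_nth) auto

text \<open>The cell is read off from \<open>u\<close> by pulling its atoms back along the renaming
  of \<open>Vx\<close> to \<open>a\<close>; it is listed in \<open>C\<close> because it is
  valid.\<close>

lemma cell_world_surj:
  assumes "good_cell_world a u"
  obtains i where "i < length C" "u \<inter> block {a} = cell_world (C ! i) a"
proof -
  define t where "t = {l \<in> HB {Vx}. map_atom id (\<lambda>_. a) l \<in> u}"
  have cell: "is_cell Ps ar (cell_of t)"
    by (rule is_cell_of_atoms) (auto simp: t_def)
  have "{l. Atm l \<in> cell_of t} = t"
    by (auto simp: cell_of_def)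
  then have eq: "u \<inter> block {a} = cell_world (cell_of t) a"
    by (auto simp: cell_world_def block_single_image t_def)
  then have "u \<inter> block {a} = cell_world (cell_of t) a \<inter> block {a}"
    by blast
  then have "is_valid (cell_of t)"
    using good_cell_world_iff_valid[OF cell, of a] good_cell_world_cong[of u a] assms by blast
  then obtain i where "i < length C" "C ! i = cell_of t"
    using set_C by (metis in_set_conv_nth mem_Collect_eq)
  with eq show thesis by (intro that[of i]) simp_all
qed

text \<open>Distinctness of \<open>C\<close> makes the index of a cell unique, and completeness of
  \<open>C\<close> supplies an index for every admissible cell.\<close>

lemma bij_betw_assignment_world:
  "bij_betw (assignment_world n) ({1..n} \<rightarrow>\<^sub>E {..<length C})
     {u \<in> Pow (\<Union>a\<in>{1..n}. block {a}). \<forall>a\<in>{1..n}. good_cell_world a u}"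
  unfolding bij_betw_def
proof (intro conjI inj_onI subset_antisym subsetI)
  fix f g assume f: "f \<in> {1..n} \<rightarrow>\<^sub>E {..<length C}" and g: "g \<in> {1..n} \<rightarrow>\<^sub>E {..<length C}"
    and eq: "assignment_world n f = assignment_world n g"
  show "f = g"
  proof (rule PiE_ext[OF f g])
    fix a assume a: "a \<in> {1..n}"
    then have lt: "f a < length C" "g a < length C"
      using f g by auto
    have "cell_world (C ! f a) a = cell_world (C ! g a) a"
      using assignment_world_block[OF f a] assignment_world_block[OF g a] eq by simp
    then have "C ! f a = C ! g a"
      using lt by (simp add: cell_world_eq_iff is_cell_nth)
    then show "f a = g a"
      using lt distinct_C by (simp add: nth_eq_iff_index_eq)
  qed
next
  fix u assume "u \<in> assignment_world n ` ({1..n} \<rightarrow>\<^sub>E {..<length C})"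
  then obtain f where f: "f \<in> {1..n} \<rightarrow>\<^sub>E {..<length C}" and u: "u = assignment_world n f"
    by blast
  have "good_cell_world a u" if "a \<in> {1..n}" for a
  proof -
    have lt: "f a < length C"
      using f that by auto
    have eq: "u \<inter> block {a} = cell_world (C ! f a) a \<inter> block {a}"
      unfolding u assignment_world_block[OF f that]
      by (rule inf.absorb1[symmetric]) (rule cell_world_subset[OF is_cell_nth[OF lt]])
    show ?thesis
      unfolding good_cell_world_cong[OF eq] good_cell_world_iff_valid[OF is_cell_nth[OF lt]]
      by (rule valid_nth[OF lt])
  qed
  with assignment_world_subset[OF f]
  show "u \<in> {u \<in> Pow (\<Union>a\<in>{1..n}. block {a}). \<forall>a\<in>{1..n}. good_cell_world a u}"
    unfolding u by (intro CollectI conjI PowI ballI)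
next
  fix u assume u: "u \<in> {u \<in> Pow (\<Union>a\<in>{1..n}. block {a}). \<forall>a\<in>{1..n}. good_cell_world a u}"
  have "\<forall>a\<in>{1..n}. \<exists>i. i < length C \<and> u \<inter> block {a} = cell_world (C ! i) a"
  proof
    fix a assume "a \<in> {1..n}"
    with u have "good_cell_world a u"
      by simp
    then obtain i where "i < length C" "u \<inter> block {a} = cell_world (C ! i) a"
      by (rule cell_world_surj)
    then show "\<exists>i. i < length C \<and> u \<inter> block {a} = cell_world (C ! i) a"
      by blast
  qed
  from bchoice[OF this] obtain f
    where f: "\<forall>a\<in>{1..n}. f a < length C \<and> u \<inter> block {a} = cell_world (C ! f a) a" ..
  \<comment> \<open>A world on single-constant atoms is the union of its traces, so the cells chosen
    constant by constant glue back to \<open>u\<close>.\<close>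
  have "u = (\<Union>a\<in>{1..n}. u \<inter> block {a})"
    using u by blast
  also have "\<dots> = assignment_world n (restrict f {1..n})"
    using f by (simp add: assignment_world_def)
  finally show "u \<in> assignment_world n ` ({1..n} \<rightarrow>\<^sub>E {..<length C})"
    by (rule ssubst) (use f in \<open>auto intro!: imageI\<close>)
qed

lemma wfomc_ordered_eq_sum_assignments:
  "wfomc_ordered Ps ar le \<psi> w wb n = (\<Sum>f\<in>{1..n} \<rightarrow>\<^sub>E {..<length C}.
      (\<Prod>a\<in>{1..n}. cell_weight Ps ar \<psi> w wb a (C ! f a)) *
      (\<Prod>(a, b)\<in>ordered_pairs n. pair_weight Ps ar le \<psi> w wb b a (C ! f b) (C ! f a)))"
proof -
  let ?U = "\<Union>a\<in>{1..n}. block {a}"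
  let ?K = "\<lambda>u. \<Prod>(a, b)\<in>ordered_pairs n. \<Sum>x\<in>Pow (block {a, b}).
         of_bool (good_pair_world a b (u \<union> x)) * weight (block {a, b}) x"
  let ?G = "\<lambda>u. \<Prod>a\<in>{1..n}. weight (block {a}) u"
  have "wfomc_ordered Ps ar le \<psi> w wb n
      = (\<Sum>u\<in>Pow ?U. of_bool (\<forall>a\<in>{1..n}. good_cell_world a u) * (?G u * ?K u))"
    unfolding wfomc_ordered_factor by (simp only: prod_of_bool_mult finite_atLeastAtMost mult.assoc)
  also have "\<dots> = (\<Sum>u | u \<in> Pow ?U \<and> (\<forall>a\<in>{1..n}. good_cell_world a u). ?G u * ?K u)"
    by (rule sum_filter_eq_sum_of_bool[symmetric]) simp
  also have "\<dots> = (\<Sum>f\<in>{1..n} \<rightarrow>\<^sub>E {..<length C}. ?G (assignment_world n f) * ?K (assignment_world n f))"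
    by (rule sum.reindex_bij_betw[OF bij_betw_assignment_world, symmetric])
  also have "\<dots> = (\<Sum>f\<in>{1..n} \<rightarrow>\<^sub>E {..<length C}.
      (\<Prod>a\<in>{1..n}. cell_weight Ps ar \<psi> w wb a (C ! f a)) *
      (\<Prod>(a, b)\<in>ordered_pairs n. pair_weight Ps ar le \<psi> w wb b a (C ! f b) (C ! f a)))"
  proof (intro sum.cong refl arg_cong2[where f = "(*)"] prod.cong)
    fix f a assume f: "f \<in> {1..n} \<rightarrow>\<^sub>E {..<length C}" and a: "a \<in> {1..n}"
    have lt: "f a < length C"
      using f a by auto
    show "weight (block {a}) (assignment_world n f) = cell_weight Ps ar \<psi> w wb a (C ! f a)"
      unfolding cell_weight_eq[OF valid_nth[OF lt]]
      by (rule world_weight_cong)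
        (use assignment_world_block[OF f a] cell_world_subset[OF is_cell_nth[OF lt], of a] in auto)
  next
    fix f i assume f: "f \<in> {1..n} \<rightarrow>\<^sub>E {..<length C}" and i: "i \<in> ordered_pairs n"
    obtain a b where ab: "i = (a, b)"
      by fastforce
    have a: "a \<in> {1..n}" and b: "b \<in> {1..n}" and ne: "b \<noteq> a"
      using i ab by (auto simp: ordered_pairs_def)
    have lt: "f a < length C" "f b < length C"
      using f a b by auto
    \<comment> \<open>The assignment world has no atom of the pair block, so it adds nothing to the
      free part \<open>x\<close>.\<close>
    have disj: "?U \<inter> block {a, b} = {}"
      using cell_pair_blocks_disjoint[of n] i ab by blast
    have "good_pair_world a b (assignment_world n f \<union> x)
        \<longleftrightarrow> good_pair_world a b (cell_world (C ! f b) b \<union> cell_world (C ! f a) a \<union> x)" for x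
    proof (rule good_pair_world_cong)
      have "cell_world (C ! f a) a \<subseteq> block {a}" "cell_world (C ! f b) b \<subseteq> block {b}"
        using lt by (simp_all add: cell_world_subset is_cell_nth)
      moreover have "block {a} \<inter> block {b} = {}"
        using ne by (intro atom_block_disjoint) auto
      moreover have "block {a} \<subseteq> ?U" "block {b} \<subseteq> ?U"
        using a b by blast+
      ultimately show "(assignment_world n f \<union> x) \<inter> HB {a, b}
          = (cell_world (C ! f b) b \<union> cell_world (C ! f a) a \<union> x) \<inter> HB {a, b}"
        unfolding HB_pair
        using assignment_world_block[OF f a] assignment_world_block[OF f b]
          assignment_world_subset[OF f] disj
        by blast
    qed
    then show "(case i of (a, b) \<Rightarrow> \<Sum>x\<in>Pow (block {a, b}).
          of_bool (good_pair_world a b (assignment_world n f \<union> x)) * weight (block {a, b}) x)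
        = (case i of (a, b) \<Rightarrow> pair_weight Ps ar le \<psi> w wb b a (C ! f b) (C ! f a))"
      using pair_weight_eq[OF ne is_cell_nth[OF lt(2)] is_cell_nth[OF lt(1)]]
      by (simp add: ab insert_commute)
  qed
  finally show ?thesis .
qed

text \<open>The weights at the actual domain elements are replaced by those at \<open>A\<close> and
  \<open>B\<close>, with the later element in the role of \<open>A\<close>. What remains depends on
  cell indices only, as the algorithm requires.\<close>

lemma wfomc_ordered_eq_sum_cell_seqs:
  assumes "A \<noteq> B"
  shows "wfomc_ordered Ps ar le \<psi> w wb n = (\<Sum>xs\<in>cell_seqs (length C) n.
    seq_weight (\<lambda>k. cell_weight Ps ar \<psi> w wb A (C ! k))
      (\<lambda>i j. pair_weight Ps ar le \<psi> w wb A B (C ! i) (C ! j)) xs)"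
  unfolding wfomc_ordered_eq_sum_assignments sum_functions_eq_sum_seqs[symmetric]
proof (intro sum.cong refl arg_cong2[where f = "(*)"] prod.cong)
  fix f a assume "f \<in> {1..n} \<rightarrow>\<^sub>E {..<length C}" "a \<in> {1..n}"
  then show "cell_weight Ps ar \<psi> w wb a (C ! f a) = cell_weight Ps ar \<psi> w wb A (C ! f a)"
    by (intro cell_weight_indep valid_nth) auto
next
  fix f i assume f: "f \<in> {1..n} \<rightarrow>\<^sub>E {..<length C}" and i: "i \<in> ordered_pairs n"
  then have "f (fst i) < length C" "f (snd i) < length C" "snd i \<noteq> fst i"
    by (auto simp: ordered_pairs_def)
  then show "(case i of (a, b) \<Rightarrow> pair_weight Ps ar le \<psi> w wb b a (C ! f b) (C ! f a))
      = (case i of (a, b) \<Rightarrow> pair_weight Ps ar le \<psi> w wb A B (C ! f b) (C ! f a))"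
    using pair_weight_indep[of "snd i" "fst i", OF _ assms] by (simp add: case_prod_beta is_cell_nth)
qed

end

end

theorem theorem3:
  fixes Ps :: "'p set" and ar :: "'p \<Rightarrow> nat" and le :: 'p
    and \<psi> :: "('p, var) atom fm" and w wb :: "'p \<Rightarrow> real"
    and C :: "('p, var) atom fm set list" and A B :: 'c
  assumes "finite Ps"
    and "\<And>P. P \<in> Ps \<Longrightarrow> ar P = 1 \<or> ar P = 2"
    and "le \<in> Ps" and "ar le = 2"
    and "set_fm \<psi> \<subseteq> atoms_over Ps ar UNIV"
    and "w le = 1" and "wb le = 1"
    and "distinct C" and "set C = {c. valid_cell Ps ar le \<psi> c}"
    and "A \<noteq> B"
  shows "(\<forall>n\<ge>1.
            result (incremental_wfomc (length C)
                (\<lambda>k. cell_weight Ps ar \<psi> w wb A (C ! k))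
                (\<lambda>i j. pair_weight Ps ar le \<psi> w wb A B (C ! i) (C ! j)) n)
              = wfomc_ordered Ps ar le \<psi> w wb n) \<and>
         (\<exists>q :: nat poly. \<forall>n\<ge>1.
            steps (incremental_wfomc (length C)
                (\<lambda>k. cell_weight Ps ar \<psi> w wb A (C ! k))
                (\<lambda>i j. pair_weight Ps ar le \<psi> w wb A B (C ! i) (C ! j)) n)
              \<le> poly q n)"
proof -
  interpret ordered_fo2 Ps ar le \<psi> w wb
    by unfold_locales (use assms in auto)
  show ?thesis
    using steps_incremental_wfomc_poly
    by (simp add: result_incremental_wfomc wfomc_ordered_eq_sum_cell_seqs[OF assms(8-10)])
qed

end
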